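(* Let $G=(V,E)$ be a finite, connected (simple) graph. Let $(X_n)_{n\ge 0}$ be a simple random walk on $G$ (with $X_0$ having an arbitrary distribution on $V$), and let $\tau_{\mathrm{cov}}:=\min\{n\ge 0 : \{X_0,\dots,X_n\}=V\}$ be its cover time. Let $T$ be the random tree formed by all the last-exit edges of the walk stopped at time $\tau_{\mathrm{cov}}$. Then $T$ has the law $\mathsf{UST}(G)$, i.e., $T$ is a uniformly random spanning tree of $G$.
   Context: Simple random walk on $G$ is the Markov chain on $V$ with transition probabilities $p(x,y)=\frac{1}{\deg(x)}\mathbf 1_{\{x\sim y\}}$, where $x\sim y$ means that $\{x,y\}\in E$. For a finite path $\gamma=(v_0,\dots,v_n)$ in $G$ (so $v_{i-1}\sim v_i$ for $1\le i\le n$) and a vertex $u\in\{v_0,\dots,v_n\}\setminus\{v_n\}$, let $i\le n-1$ be the largest index with $v_i=u$; the last-exit edge of $u$ is the (unoriented) edge $\{v_i,v_{i+1}\}$ of $G$. The last-exit edges of all vertices of $\gamma$ other than $v_n$ form a tree on the vertex set $\{v_0,\dots,v_n\}$. In the claim this is applied to the path $(X_0,\dots,X_{\tau_{\mathrm{cov}}})$. $\mathsf{UST}(G)$ (the uniform spanning tree) denotes the uniform probability measure on the finite set of spanning trees of $G$. *)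

theory Defs
  imports "HOL-Probability.Probability"
begin

section \<open>Finite simple graphs and spanning trees\<close>

text \<open>A graph is a vertex set together with a set of unoriented edges, each a two-element set.\<close>

definition finite_simple_graph :: "'a set \<Rightarrow> 'a set set \<Rightarrow> bool" where
  "finite_simple_graph V E \<longleftrightarrow> finite V \<and> V \<noteq> {} \<and> (\<forall>e\<in>E. e \<subseteq> V \<and> card e = 2)"

definition graph_path :: "'a set \<Rightarrow> 'a set set \<Rightarrow> 'a list \<Rightarrow> bool" where
  "graph_path V E p \<longleftrightarrow> p \<noteq> [] \<and> set p \<subseteq> V \<and> successively (\<lambda>u v. {u, v} \<in> E) p"

definition graph_connected :: "'a set \<Rightarrow> 'a set set \<Rightarrow> bool" where
  "graph_connected V E \<longleftrightarrow>
     (\<forall>u\<in>V. \<forall>v\<in>V. \<exists>p. graph_path V E p \<and> hd p = u \<and> last p = v)"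

text \<open>A cycle is listed without repeating its initial vertex; the closing edge joins
  the last vertex to the first.\<close>

definition graph_cycle :: "'a set \<Rightarrow> 'a set set \<Rightarrow> 'a list \<Rightarrow> bool" where
  "graph_cycle V E p \<longleftrightarrow>
     graph_path V E p \<and> distinct p \<and> length p \<ge> 3 \<and> {last p, hd p} \<in> E"

definition is_tree :: "'a set \<Rightarrow> 'a set set \<Rightarrow> bool" where
  "is_tree V F \<longleftrightarrow>
     finite_simple_graph V F \<and> graph_connected V F \<and> (\<nexists>p. graph_cycle V F p)"

text \<open>Since a spanning tree of \<open>(V, E)\<close> has vertex set \<open>V\<close>, it is identified with its edge set.\<close>

definition spanning_trees :: "'a set \<Rightarrow> 'a set set \<Rightarrow> 'a set set set" where
  "spanning_trees V E = {F. F \<subseteq> E \<and> is_tree V F}"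

definition UST :: "'a set \<Rightarrow> 'a set set \<Rightarrow> 'a set set pmf" where
  "UST V E = pmf_of_set (spanning_trees V E)"


section \<open>Simple random walk\<close>

definition graph_degree :: "'a set \<Rightarrow> 'a set set \<Rightarrow> 'a \<Rightarrow> nat" where
  "graph_degree V E x = card {y\<in>V. {x, y} \<in> E}"

text \<open>In a connected graph a vertex has degree zero only if it is the sole vertex; the expression
  \<open>1 / deg x\<close> is then meaningless, and the usual convention that the walk stays put is adopted.\<close>

definition srw_prob :: "'a set \<Rightarrow> 'a set set \<Rightarrow> 'a \<Rightarrow> 'a \<Rightarrow> real" where
  "srw_prob V E x y =
     (if graph_degree V E x = 0 then (if y = x then 1 else 0)
      else 1 / real (graph_degree V E x) * (if {x, y} \<in> E then 1 else 0))"

definition simple_random_walk ::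
    "'a set \<Rightarrow> 'a set set \<Rightarrow> 'w measure \<Rightarrow> (nat \<Rightarrow> 'w \<Rightarrow> 'a) \<Rightarrow> bool" where
  "simple_random_walk V E M X \<longleftrightarrow>
     prob_space M \<and>
     (\<forall>n. X n \<in> measurable M (count_space V)) \<and>
     (\<forall>n x. \<forall>y\<in>V. \<P>(\<omega> in M. \<forall>i\<le>n. X i \<omega> = x i) > 0 \<longrightarrow>
        \<P>(\<omega> in M. X (Suc n) \<omega> = y \<bar> \<forall>i\<le>n. X i \<omega> = x i) = srw_prob V E (x n) y)"


section \<open>Cover time and last-exit tree\<close>

text \<open>The infimum of the empty set is \<open>\<infinity>\<close>.\<close>

definition cover_time :: "'a set \<Rightarrow> (nat \<Rightarrow> 'a) \<Rightarrow> enat" where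
  "cover_time V x = Inf {enat n | n. x ` {..n} = V}"

text \<open>In the next three definitions the path is \<open>x 0, \<dots>, x n\<close>.\<close>

definition last_exit_index :: "(nat \<Rightarrow> 'a) \<Rightarrow> nat \<Rightarrow> 'a \<Rightarrow> nat" where
  "last_exit_index x n u = Max {i. i < n \<and> x i = u}"

definition last_exit_edge :: "(nat \<Rightarrow> 'a) \<Rightarrow> nat \<Rightarrow> 'a \<Rightarrow> 'a set" where
  "last_exit_edge x n u =
     {x (last_exit_index x n u), x (Suc (last_exit_index x n u))}"

definition last_exit_edges :: "(nat \<Rightarrow> 'a) \<Rightarrow> nat \<Rightarrow> 'a set set" where
  "last_exit_edges x n = last_exit_edge x n ` (x ` {..n} - {x n})"

text \<open>The value \<open>{}\<close> on trajectories that never cover is a dummy.  It is not a spanning tree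
  unless there is only one vertex, in which case the cover time is \<open>0\<close>.\<close>

definition last_exit_tree :: "'a set \<Rightarrow> (nat \<Rightarrow> 'a) \<Rightarrow> 'a set set" where
  "last_exit_tree V x =
     (case cover_time V x of enat n \<Rightarrow> last_exit_edges x n | \<infinity> \<Rightarrow> {})"

end

theory Submission
  imports Defs
begin

text \<open>A walk is determined by its starting point and, for every vertex, the stack of its successive
  exits. Split off the last exits, which form the last-exit tree \<open>F\<close> directed towards the end
  point. The remaining stacks together with \<open>F\<close> come from a walk from \<open>x\<close> to \<open>y\<close> iff a flow
  condition holds that is symmetric in \<open>x\<close> and \<open>y\<close> (the BEST theorem). Hence redirecting \<open>F\<close>
  towards \<open>x\<close> and reversing time gives a bijection of walks from \<open>x\<close> to \<open>y\<close> that preserves the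
  numbers of visits, and therefore the weight and the event that \<open>y\<close> is the last vertex covered,
  and turns last-exit trees into first-entry trees.

  For first-entry trees, coupling from the past (Aldous and Broder) yields the rest: prepending a
  step to a walk acts on pairs of a root and a spanning tree, and every \<open>(x, t)\<close> has at most
  \<open>deg x\<close> preimages with roots adjacent to \<open>x\<close>. So every spanning tree is hit with probability at
  most \<open>1 / N\<close>, where \<open>N\<close> is the number of spanning trees, and since the walk covers almost surely
  equality holds throughout.\<close>

section \<open>Exit stacks of a walk\<close>

definition exits :: "'a list \<Rightarrow> 'a \<Rightarrow> 'a list" where
  "exits p u = map snd (filter (\<lambda>(a, b). a = u) (zip p (tl p)))"

lemma exits_Nil [simp]: "exits [] u = []"
  by (simp add: exits_def)

lemma exits_single [simp]: "exits [x] u = []"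
  by (simp add: exits_def)

lemma exits_Cons_Cons [simp]:
  "exits (x # y # p) u = (if u = x then y # exits (y # p) u else exits (y # p) u)"
  by (simp add: exits_def)

lemma exits_Cons: "q \<noteq> [] \<Longrightarrow> exits (x # q) u = (if u = x then [hd q] else []) @ exits q u"
  by (cases q) auto

lemma exits_snoc:
  "q \<noteq> [] \<Longrightarrow> exits (q @ [x]) u = exits q u @ (if u = last q then [x] else [])"
  by (induction q rule: list_nonempty_induct) (auto simp: exits_Cons hd_append)

text \<open>Every visit is followed by an exit, except the final one. The next lemma counts the same
  visits by entries, with the initial visit as the exception. Equating the two counts gives the flow
  condition on the stacks.\<close>

lemma count_list_eq_length_exits:
  "p \<noteq> [] \<Longrightarrow> count_list p u = length (exits p u) + of_bool (u = last p)"
  by (induction p rule: list_nonempty_induct) (auto simp: exits_Cons)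

lemma count_list_eq_sum_exits:
  assumes "finite V" "p \<noteq> []" "set p \<subseteq> V"
  shows "count_list p v = (\<Sum>u\<in>V. count_list (exits p u) v) + of_bool (v = hd p)"
  using assms(2,3)
proof (induction p rule: list_nonempty_induct)
  case (cons x q)
  have "(\<Sum>u\<in>V. count_list (exits (x # q) u) v) =
      (\<Sum>u\<in>V. (if u = x then of_bool (v = hd q) else 0) + count_list (exits q u) v)"
    using cons.hyps by (intro sum.cong) (auto simp: exits_Cons)
  also have "\<dots> = of_bool (v = hd q) + (\<Sum>u\<in>V. count_list (exits q u) v)"
    using cons.prems assms(1) by (simp add: sum.distrib)
  finally show ?case
    using cons by auto
qed auto

lemma exits_eq_Nil_iff: "exits p u = [] \<longleftrightarrow> u \<notin> set (butlast p)"
proof (cases "p = []")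
  case False
  then show ?thesis
    by (induction p rule: list_nonempty_induct) (auto simp: exits_Cons)
qed auto

lemma set_exits_subset: "set (exits p u) \<subseteq> set p"
proof (cases "p = []")
  case False
  then show ?thesis
    by (induction p rule: list_nonempty_induct) (auto simp: exits_Cons split: if_splits)
qed auto

lemma successively_iff_exits:
  "successively P p \<longleftrightarrow> (\<forall>u. \<forall>v\<in>set (exits p u). P u v)"
  by (induction p rule: induct_list012) auto

text \<open>The walk is replayed from its stacks: the top of the stack at the current vertex is the
  next vertex, and an empty stack there means that the walk is over.\<close>

lemma exits_inject:
  assumes "p \<noteq> []" "q \<noteq> []" "hd p = hd q" "exits p = exits q"
  shows "p = q"
  using assms
proof (induction p arbitrary: q rule: list_nonempty_induct)
  case (single x)
  then have "exits q (hd q) = []"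
    by (metis exits_single)
  then have "tl q = []"
    using single.prems(1) by (cases q) (auto simp: exits_eq_Nil_iff split: if_splits)
  then show ?case
    using single.prems by (cases q) auto
next
  case (cons x p)
  obtain q' where q: "q = x # q'"
    using cons.prems by (cases q) auto
  have ne: "q' \<noteq> []"
  proof
    assume "q' = []"
    then have "exits (x # p) x = []"
      using cons.prems q by simp
    then show False
      using cons.hyps by (simp add: exits_Cons)
  qed
  have eq: "(if u = x then [hd p] else []) @ exits p u = (if u = x then [hd q'] else []) @ exits q' u"
    for u
    using cons.prems(3) q ne cons.hyps by (metis exits_Cons)
  from eq[of x] have "hd p = hd q'"
    by simp
  moreover have "exits p = exits q'"
  proof
    show "exits p u = exits q' u" for u
      using eq[of u] by (simp split: if_splits)
  qed
  ultimately show ?case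
    using cons.IH[of q'] ne q by simp
qed

text \<open>The existence half of the BEST theorem. The rank condition says that the last entries of
  the stacks lead to \<open>y\<close>, and it guarantees that the walk popping the stacks exhausts
  all of them.\<close>

lemma exits_surj:
  fixes s :: "'a \<Rightarrow> 'a list" and h :: "'a \<Rightarrow> nat"
  assumes "finite V" "y \<in> V"
    and "x \<in> V" "\<And>u. set (s u) \<subseteq> V" "\<And>u. u \<notin> V \<Longrightarrow> s u = []"
    and "\<And>v. v \<in> V \<Longrightarrow>
      length (s v) + of_bool (v = y) = (\<Sum>u\<in>V. count_list (s u) v) + of_bool (v = x)"
    and "\<And>u. u \<in> V - {y} \<Longrightarrow> s u \<noteq> [] \<Longrightarrow> h (last (s u)) < h u"
  shows "\<exists>p. p \<noteq> [] \<and> set p \<subseteq> V \<and> hd p = x \<and> last p = y \<and> exits p = s"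
  using assms(3-)
proof (induction "\<Sum>u\<in>V. length (s u)" arbitrary: s x rule: less_induct)
  case less
  note x = less.prems(1) and sub = less.prems(2) and out = less.prems(3)
    and bal = less.prems(4) and rank = less.prems(5)
  show ?case
  proof (cases "s x")
    case Nil
    \<comment> \<open>With an empty stack at the start, the balance at \<open>x\<close> forces
      \<open>x = y\<close> and says that no stack contains \<open>x\<close>. The walk stops here, so
      all stacks must be shown to be used up.\<close>
    with bal[OF x] have xy: "x = y" and "(\<Sum>u\<in>V. count_list (s u) x) = 0"
      by (auto split: if_splits simp: of_bool_def)
    then have no_y: "y \<notin> set (s u)" if "u \<in> V" for u
      using that assms(1) by (auto simp: count_list_0_iff)
    have "s u = []" for u
    proof (rule ccontr)
      assume "s u \<noteq> []"
      then have "\<exists>u. u \<in> V - {y} \<and> s u \<noteq> []"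
        using Nil xy out by blast
      \<comment> \<open>Take a nonempty stack of least rank. Its last entry \<open>?v\<close> is
        entered and is not the start, so by the balance it has exits too, although its rank is
        smaller.\<close>
      then obtain u where u: "u \<in> V - {y}" "s u \<noteq> []"
        and min: "\<And>v. v \<in> V - {y} \<Longrightarrow> s v \<noteq> [] \<Longrightarrow> h u \<le> h v"
        using ex_has_least_nat[of "\<lambda>u. u \<in> V - {y} \<and> s u \<noteq> []" _ h] by metis
      let ?v = "last (s u)"
      have v: "?v \<in> set (s u)"
        using u by simp
      then have "?v \<noteq> y"
        using no_y u by (metis DiffE)
      with v have vV: "?v \<in> V - {y}"
        using sub by blast
      have "(\<Sum>w\<in>V. count_list (s w) ?v) \<noteq> 0"
        using v u assms(1) by (auto simp: count_list_0_iff intro!: bexI[of _ u])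
      then have "s ?v \<noteq> []"
        using bal[of ?v] vV by auto
      then show False
        using min[OF vV] rank[OF u] by simp
    qed
    then have "exits [x] = s"
      by auto
    then show ?thesis
      using xy x by (intro exI[of _ "[x]"]) auto
  next
    case (Cons z r)
    \<comment> \<open>Popping the stack at \<open>x\<close> moves the start to \<open>z\<close>. A
      stack that stays nonempty keeps its last entry, so the same rank \<open>h\<close> still
      serves.\<close>
    let ?s = "s(x := r)"
    have z: "z \<in> V"
      using sub[of x] Cons by auto
    have cnt: "(\<Sum>u\<in>V. count_list (s u) v) = (\<Sum>u\<in>V. count_list (?s u) v) + of_bool (v = z)" for v
      using assms(1) x Cons by (simp add: sum.remove[of V x])
    have "(\<Sum>u\<in>V. length (?s u)) < (\<Sum>u\<in>V. length (s u))"
      using assms(1) x Cons by (simp add: sum.remove[of V x])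
    moreover have "set (?s u) \<subseteq> V" for u
      using sub[of u] sub[of x] Cons by auto
    moreover have "u \<notin> V \<Longrightarrow> ?s u = []" for u
      using out x by auto
    moreover have "length (?s v) + of_bool (v = y) =
        (\<Sum>u\<in>V. count_list (?s u) v) + of_bool (v = z)" if "v \<in> V" for v
      using bal[OF that] Cons unfolding cnt[of v] by (auto simp del: fun_upd_apply simp: fun_upd_def)
    moreover have "h (last (?s u)) < h u" if "u \<in> V - {y}" "?s u \<noteq> []" for u
      using rank[of u] that Cons by (auto split: if_splits)
    ultimately obtain p where p: "p \<noteq> []" "set p \<subseteq> V" "hd p = z" "last p = y" "exits p = ?s"
      using less.hyps[of ?s z] z by blast
    have "exits (x # p) = s"
      using p Cons by (auto simp: exits_Cons)
    then show ?thesis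
      using p x by (intro exI[of _ "x # p"]) auto
  qed
qed

section \<open>Last exits\<close>

definition last_exit :: "'a list \<Rightarrow> 'a \<Rightarrow> 'a" where
  "last_exit p u = last (exits p u)"

definition exit_tree :: "'a list \<Rightarrow> 'a set set" where
  "exit_tree p = (\<lambda>u. {u, last_exit p u}) ` (set p - {last p})"

text \<open>The end point has no tree edge to give up, so its stack stays whole. With this
  convention every visited vertex has exactly one more visit than excess entries, wherever the walk
  ends; so the excess and the set of visited vertices fix all visit counts.\<close>

definition excess :: "'a list \<Rightarrow> 'a \<Rightarrow> 'a list" where
  "excess p u = (if u = last p then exits p u else butlast (exits p u))"

lemma exits_nonempty:
  assumes "u \<in> set p - {last p}"
  shows "exits p u \<noteq> []"
proof -
  have "p = butlast p @ [last p]"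
    using assms by (cases "p = []") auto
  then have "set p = insert (last p) (set (butlast p))"
    by (metis list.simps(15) rotate1.simps(2) set_rotate1)
  then show ?thesis
    using assms by (auto simp: exits_eq_Nil_iff)
qed

lemma exits_eq_excess:
  "u \<in> set p \<Longrightarrow> exits p u = excess p u @ (if u = last p then [] else [last_exit p u])"
  using exits_nonempty[of u p] by (auto simp: excess_def last_exit_def)

lemma last_exit_in_set: "u \<in> set p - {last p} \<Longrightarrow> last_exit p u \<in> set p"
  using exits_nonempty[of u p] set_exits_subset[of p u] unfolding last_exit_def
  by (meson last_in_set subsetD)

lemma count_list_eq_length_excess:
  assumes "u \<in> set p"
  shows "count_list p u = Suc (length (excess p u))"
proof -
  have "p \<noteq> []"
    using assms by auto
  then show ?thesis
    using count_list_eq_length_exits[of p u] exits_eq_excess[OF assms] by auto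
qed

text \<open>A last exit leads to a vertex that is visited for the last time later on, so last exits
  cannot cycle. The rank is built from the end of the walk: a prepended new vertex hangs as a leaf
  off \<open>hd q\<close>, and a prepended old vertex changes no last exit.\<close>

lemma last_exit_rank:
  assumes "p \<noteq> []"
  shows "\<exists>h :: 'a \<Rightarrow> nat. \<forall>u\<in>set p - {last p}. h (last_exit p u) < h u"
  using assms
proof (induction p rule: list_nonempty_induct)
  case (cons x q)
  then obtain h :: "'a \<Rightarrow> nat" where h: "\<forall>u\<in>set q - {last q}. h (last_exit q u) < h u"
    by blast
  have old: "last_exit (x # q) u = last_exit q u" if "u \<in> set q - {last q}" for u
    using exits_nonempty[OF that] cons.hyps by (simp add: last_exit_def exits_Cons)
  show ?case
  proof (cases "x \<in> set q")
    case True
    then have "h (last_exit (x # q) u) < h u" if "u \<in> set (x # q) - {last (x # q)}" for u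
      using that h old[of u] cons.hyps by auto
    then show ?thesis
      by blast
  next
    case False
    let ?h = "h(x := Suc (h (hd q)))"
    from False have "exits q x = []"
      by (auto simp: exits_eq_Nil_iff dest: in_set_butlastD)
    then have x: "last_exit (x # q) x = hd q"
      using cons.hyps by (simp add: last_exit_def exits_Cons)
    have hd: "hd q \<noteq> x"
      using False cons.hyps by auto
    have "?h (last_exit (x # q) u) < ?h u" if "u \<in> set (x # q) - {last (x # q)}" for u
    proof (cases "u = x")
      case True
      then show ?thesis
        using x hd by simp
    next
      case u: False
      then have "u \<in> set q - {last q}"
        using that cons.hyps by auto
      moreover from this have "last_exit q u \<noteq> x"
        using last_exit_in_set False by metis
      ultimately show ?thesis
        using h old[of u] u by simp
    qed
    then show ?thesis
      by blast
  qed
qed auto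

section \<open>Rooted trees\<close>

text \<open>The strictly decreasing rank \<open>h\<close> says that following parents ends at
  \<open>r\<close>. The value of \<open>\<pi>\<close> at \<open>r\<close> is unconstrained, so
  moving the root from \<open>z\<close> to \<open>x\<close> is the single update
  \<open>\<pi>(z := x)\<close>.\<close>

definition rooted_tree :: "'a set \<Rightarrow> 'a \<Rightarrow> ('a \<Rightarrow> 'a) \<Rightarrow> 'a set set \<Rightarrow> bool" where
  "rooted_tree V r \<pi> F \<longleftrightarrow>
     r \<in> V \<and> (\<exists>h :: 'a \<Rightarrow> nat. \<forall>u\<in>V - {r}. \<pi> u \<in> V \<and> h (\<pi> u) < h u) \<and>
     F = (\<lambda>u. {u, \<pi> u}) ` (V - {r})"

lemma rooted_tree_cong:
  assumes "\<And>u. u \<in> V - {r} \<Longrightarrow> \<pi> u = \<rho> u"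
  shows "rooted_tree V r \<pi> F \<longleftrightarrow> rooted_tree V r \<rho> F"
proof -
  have "(\<lambda>u. {u, \<pi> u}) ` (V - {r}) = (\<lambda>u. {u, \<rho> u}) ` (V - {r})"
    using assms by (intro image_cong) auto
  then show ?thesis
    unfolding rooted_tree_def by (simp add: assms)
qed

lemma rooted_tree_edges: "rooted_tree V r \<pi> F \<Longrightarrow> F = (\<lambda>u. {u, \<pi> u}) ` (V - {r})"
  by (simp add: rooted_tree_def)

lemma rooted_tree_parent:
  assumes "rooted_tree V r \<pi> F" "u \<in> V - {r}"
  shows "\<pi> u \<in> V" "\<pi> u \<noteq> u" "{u, \<pi> u} \<in> F"
  using assms unfolding rooted_tree_def by (blast, metis less_irrefl, blast)

text \<open>If the parents of \<open>u\<close> differ, then \<open>\<rho>\<close> can only produce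
  the edge \<open>{u, \<pi> u}\<close> as the edge from \<open>\<pi> u\<close> to \<open>u\<close>.
  By induction on the rank, \<open>\<pi>\<close> also sends \<open>\<pi> u\<close> back to
  \<open>u\<close>, against the rank.\<close>

lemma rooted_tree_unique:
  assumes "rooted_tree V r \<pi> F" "rooted_tree V r \<rho> F" "u \<in> V - {r}"
  shows "\<pi> u = \<rho> u"
proof -
  obtain h :: "'a \<Rightarrow> nat" where h: "\<forall>u\<in>V - {r}. \<pi> u \<in> V \<and> h (\<pi> u) < h u"
    using assms(1) by (auto simp: rooted_tree_def)
  show ?thesis
    using assms(3)
  proof (induction "h u" arbitrary: u rule: less_induct)
    case less
    show ?case
    proof (rule ccontr)
      assume ne: "\<pi> u \<noteq> \<rho> u"
      have "{u, \<pi> u} \<in> (\<lambda>u. {u, \<rho> u}) ` (V - {r})"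
        using less.prems assms(1,2) by (auto simp: rooted_tree_def)
      then have v: "\<pi> u \<in> V - {r}" "\<rho> (\<pi> u) = u"
        using ne by (auto simp: doubleton_eq_iff)
      then have "\<pi> (\<pi> u) = u"
        using less.hyps[of "\<pi> u"] h less.prems by auto
      then show False
        using h less.prems v by (metis less_asym)
    qed
  qed
qed

text \<open>This trades the number of children, which depends on the root, for the degree in
  \<open>F\<close>, which does not. It is the source of the symmetry of the flow condition in the
  two end points.\<close>

lemma rooted_tree_degree:
  assumes "rooted_tree V r \<pi> F" "finite V" "v \<in> V"
  shows "card {e \<in> F. v \<in> e} + of_bool (v = r) = card {u \<in> V - {r}. \<pi> u = v} + 1"
proof -
  obtain h :: "'a \<Rightarrow> nat" where h: "\<forall>u\<in>V - {r}. \<pi> u \<in> V \<and> h (\<pi> u) < h u"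
    and F: "F = (\<lambda>u. {u, \<pi> u}) ` (V - {r})"
    using assms(1) by (auto simp: rooted_tree_def)
  have inj: "inj_on (\<lambda>u. {u, \<pi> u}) (V - {r})"
  proof (rule inj_onI)
    fix u w assume *: "u \<in> V - {r}" "w \<in> V - {r}" "{u, \<pi> u} = {w, \<pi> w}"
    have "\<not> (u = \<pi> w \<and> w = \<pi> u)"
      using h * by (metis less_asym)
    then show "u = w"
      using *(3) by (auto simp: doubleton_eq_iff)
  qed
  let ?C = "{u \<in> V - {r}. \<pi> u = v}"
  have "{e \<in> F. v \<in> e} = (\<lambda>u. {u, \<pi> u}) ` {u \<in> V - {r}. u = v \<or> \<pi> u = v}"
    unfolding F by auto
  then have "card {e \<in> F. v \<in> e} = card {u \<in> V - {r}. u = v \<or> \<pi> u = v}"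
    using inj by (simp add: card_image inj_on_def)
  also have "{u \<in> V - {r}. u = v \<or> \<pi> u = v} = (if v = r then ?C else insert v ?C)"
    using assms(3) by auto
  finally show ?thesis
    using rooted_tree_parent(2)[OF assms(1), of v] assms(2,3) by (auto simp: card_insert_if)
qed

lemma rooted_tree_step:
  assumes "rooted_tree V z \<pi> F" "x \<in> V" "x \<noteq> z"
  shows "rooted_tree V x (\<pi>(z := x)) ((\<lambda>u. {u, (\<pi>(z := x)) u}) ` (V - {x}))"
proof -
  obtain h :: "'a \<Rightarrow> nat" where h: "\<forall>u\<in>V - {z}. \<pi> u \<in> V \<and> h (\<pi> u) < h u"
    using assms(1) by (auto simp: rooted_tree_def)
  \<comment> \<open>The new root gets rank 0 and the old root rank 1; all other ranks are shifted
    above both.\<close>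
  have "\<forall>u\<in>V - {x}. (\<pi>(z := x)) u \<in> V \<and>
      ((\<lambda>u. h u + 2)(x := 0, z := 1)) ((\<pi>(z := x)) u) < ((\<lambda>u. h u + 2)(x := 0, z := 1)) u"
    using h assms(2,3) by auto
  then show ?thesis
    unfolding rooted_tree_def using assms(2) by blast
qed

lemma exit_tree_rooted:
  assumes "set p = V" "p \<noteq> []"
  shows "rooted_tree V (last p) (last_exit p) (exit_tree p)"
proof -
  obtain h :: "'a \<Rightarrow> nat" where "\<forall>u\<in>set p - {last p}. h (last_exit p u) < h u"
    using last_exit_rank[OF assms(2)] by blast
  then show ?thesis
    unfolding rooted_tree_def exit_tree_def using assms last_exit_in_set[of _ p] by auto
qed

section \<open>Parent functions and connected acyclic graphs\<close>

abbreviation "adj V F \<equiv> {(u, v). u \<in> V \<and> v \<in> V \<and> {u, v} \<in> F}"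

lemma graph_path_iff_rtrancl:
  assumes "v \<in> V"
  shows "(\<exists>p. graph_path V F p \<and> hd p = u \<and> last p = v) \<longleftrightarrow> (u, v) \<in> (adj V F)\<^sup>*"
proof
  assume "\<exists>p. graph_path V F p \<and> hd p = u \<and> last p = v"
  then obtain p where "p \<noteq> []" "graph_path V F p" "hd p = u" "last p = v"
    by (auto simp: graph_path_def)
  then show "(u, v) \<in> (adj V F)\<^sup>*"
  proof (induction p arbitrary: u rule: list_nonempty_induct)
    case (cons x q)
    then have "(x, hd q) \<in> adj V F" "(hd q, v) \<in> (adj V F)\<^sup>*"
      by (auto simp: graph_path_def successively_Cons)
    then have "(x, v) \<in> (adj V F)\<^sup>*"
      by (rule converse_rtrancl_into_rtrancl)
    then show ?case
      using cons.prems(2) by simp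
  qed auto
next
  assume "(u, v) \<in> (adj V F)\<^sup>*"
  then show "\<exists>p. graph_path V F p \<and> hd p = u \<and> last p = v"
  proof (induction rule: converse_rtrancl_induct)
    case base
    then show ?case
      using assms by (intro exI[of _ "[v]"]) (auto simp: graph_path_def)
  next
    case (step y z)
    then obtain p where "graph_path V F p" "hd p = z" "last p = v"
      by blast
    then show ?case
      using step.hyps by (intro exI[of _ "y # p"]) (auto simp: graph_path_def successively_Cons)
  qed
qed

lemma graph_connected_iff_rtrancl:
  "graph_connected V F \<longleftrightarrow> (\<forall>u\<in>V. \<forall>v\<in>V. (u, v) \<in> (adj V F)\<^sup>*)"
  unfolding graph_connected_def by (intro ball_cong refl graph_path_iff_rtrancl)

lemma graph_path_distinct:
  assumes "graph_path V F p"
  shows "\<exists>q. graph_path V F q \<and> hd q = hd p \<and> last q = last p \<and> distinct q"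
  using assms
proof (induction "length p" arbitrary: p rule: less_induct)
  case less
  show ?case
  proof (cases "distinct p")
    case True
    then show ?thesis
      using less.prems by blast
  next
    case False
    then obtain xs y ys zs where p: "p = xs @ [y] @ ys @ [y] @ zs"
      using not_distinct_decomp by blast
    let ?q = "xs @ [y] @ zs"
    have q: "graph_path V F ?q"
      using less.prems unfolding p
      by (auto simp: graph_path_def successively_append_iff successively_Cons hd_append split: if_splits)
    have len: "length ?q < length p" and ends: "hd ?q = hd p" "last ?q = last p"
      unfolding p by (auto simp: hd_append)
    obtain r where "graph_path V F r" "hd r = hd ?q" "last r = last ?q" "distinct r"
      using less.hyps[OF len q] by blast
    then show ?thesis
      unfolding ends by blast
  qed
qed

lemma rooted_tree_connected:
  assumes "rooted_tree V r \<pi> F"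
  shows "graph_connected V F"
proof -
  obtain h :: "'a \<Rightarrow> nat" where h: "\<forall>u\<in>V - {r}. \<pi> u \<in> V \<and> h (\<pi> u) < h u"
    using assms by (auto simp: rooted_tree_def)
  have to_r: "(u, r) \<in> (adj V F)\<^sup>*" if "u \<in> V" for u
    using that
  proof (induction "h u" arbitrary: u rule: less_induct)
    case less
    show ?case
    proof (cases "u = r")
      case False
      then have "(u, \<pi> u) \<in> adj V F"
        using rooted_tree_parent[OF assms, of u] less.prems by auto
      moreover have "(\<pi> u, r) \<in> (adj V F)\<^sup>*"
        using less h False by auto
      ultimately show ?thesis
        by (rule converse_rtrancl_into_rtrancl)
    qed auto
  qed
  have sym: "sym ((adj V F)\<^sup>*)"
    by (intro sym_rtrancl symI) (auto simp: insert_commute)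
  have "(u, v) \<in> (adj V F)\<^sup>*" if "u \<in> V" "v \<in> V" for u v
    using to_r[OF that(1)] symD[OF sym to_r[OF that(2)]] by (rule rtrancl_trans)
  then show ?thesis
    unfolding graph_connected_iff_rtrancl by blast
qed

text \<open>On a cycle, a vertex of maximal rank has two distinct neighbours of at most its own
  rank. Every edge joins a vertex to its parent of smaller rank, so both neighbours would be its one
  parent.\<close>

lemma rooted_tree_acyclic:
  assumes "rooted_tree V r \<pi> F"
  shows "\<not> graph_cycle V F p"
proof
  assume p: "graph_cycle V F p"
  obtain h :: "'a \<Rightarrow> nat" where h: "\<forall>u\<in>V - {r}. \<pi> u \<in> V \<and> h (\<pi> u) < h u"
    and F: "F = (\<lambda>u. {u, \<pi> u}) ` (V - {r})"
    using assms by (auto simp: rooted_tree_def)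
  let ?n = "length p"
  have n: "?n \<ge> 3" and d: "distinct p"
    using p by (auto simp: graph_cycle_def)
  have "{..<?n} \<noteq> {}"
    using n by (auto simp: lessThan_empty_iff)
  then have "Max ((\<lambda>i. h (p ! i)) ` {..<?n}) \<in> (\<lambda>i. h (p ! i)) ` {..<?n}"
    by (intro Max_in) auto
  then obtain i where i: "i < ?n" and "h (p ! i) = Max ((\<lambda>i. h (p ! i)) ` {..<?n})"
    by auto
  then have max: "h (p ! j) \<le> h (p ! i)" if "j < ?n" for j
    using that by auto
  have edge: "{p ! j, p ! (Suc j mod ?n)} \<in> F" if "j < ?n" for j
  proof (cases "Suc j < ?n")
    case True
    then show ?thesis
      using p by (auto simp: graph_cycle_def graph_path_def successively_conv_nth)
  next
    case False
    then have "j = ?n - 1" "Suc j = ?n"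
      using that by auto
    moreover have "p \<noteq> []"
      using n by auto
    ultimately show ?thesis
      using p by (auto simp: graph_cycle_def last_conv_nth hd_conv_nth)
  qed
  have up: "w = \<pi> (p ! i)" if w: "{p ! i, w} \<in> F" "w \<in> set p" "w \<noteq> p ! i" for w
  proof -
    have "h w \<le> h (p ! i)"
      using max w(2) by (auto simp: in_set_conv_nth)
    moreover obtain c where c: "c \<in> V - {r}" "{p ! i, w} = {c, \<pi> c}"
      using w(1) unfolding F by blast
    moreover have "h (\<pi> c) < h c"
      using h c(1) by blast
    ultimately show ?thesis
      by (auto simp: doubleton_eq_iff)
  qed
  \<comment> \<open>The cyclic predecessor of \<open>i\<close>. It differs from the successor
    because the cycle has at least three vertices.\<close>
  define j where "j = (if i = 0 then ?n - 1 else i - 1)"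
  have j: "j < ?n" "Suc j mod ?n = i" "j \<noteq> i" "Suc i mod ?n < ?n" "Suc i mod ?n \<noteq> i" "Suc i mod ?n \<noteq> j"
    using n i by (auto simp: j_def mod_Suc)
  have "p ! (Suc i mod ?n) = \<pi> (p ! i)"
    using up[of "p ! (Suc i mod ?n)"] edge[OF i] j d i by (auto simp: nth_eq_iff_index_eq)
  moreover have "p ! j = \<pi> (p ! i)"
    using up[of "p ! j"] edge[OF j(1)] j d i by (auto simp: nth_eq_iff_index_eq insert_commute)
  ultimately show False
    using j d i by (metis nth_eq_iff_index_eq)
qed

lemma rooted_tree_imp_is_tree:
  assumes "rooted_tree V r \<pi> F" "finite V"
  shows "is_tree V F"
proof -
  have "e \<subseteq> V \<and> card e = 2" if e: "e \<in> F" for e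
  proof -
    obtain u where "u \<in> V - {r}" "e = {u, \<pi> u}"
      using e unfolding rooted_tree_edges[OF assms(1)] by blast
    then show ?thesis
      using rooted_tree_parent[OF assms(1), of u] by auto
  qed
  moreover have "V \<noteq> {}"
    using assms(1) by (auto simp: rooted_tree_def)
  ultimately show ?thesis
    using assms(2) rooted_tree_connected[OF assms(1)] rooted_tree_acyclic[OF assms(1)]
    unfolding is_tree_def finite_simple_graph_def by simp
qed

text \<open>Every vertex picks a neighbour closer to \<open>r\<close> in the graph distance
  \<open>d\<close>. These parent edges already connect \<open>V\<close>, so any further edge of
  \<open>F\<close> would close a cycle.\<close>

lemma is_tree_imp_rooted_tree:
  assumes "is_tree V F" "r \<in> V"
  shows "\<exists>\<pi>. rooted_tree V r \<pi> F"
proof -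
  have edges: "\<And>e. e \<in> F \<Longrightarrow> e \<subseteq> V \<and> card e = 2" and con: "graph_connected V F"
    and acyclic: "\<And>p. \<not> graph_cycle V F p"
    using assms(1) by (auto simp: is_tree_def finite_simple_graph_def)
  define d where "d u = (LEAST n. (u, r) \<in> adj V F ^^ n)" for u
  have "\<exists>v. {u, v} \<in> F \<and> v \<in> V \<and> d v < d u" if "u \<in> V - {r}" for u
  proof -
    have "\<exists>n. (u, r) \<in> adj V F ^^ n"
      using con that assms(2) unfolding graph_connected_iff_rtrancl
      by (meson DiffD1 rtrancl_imp_relpow)
    then have du: "(u, r) \<in> adj V F ^^ d u"
      unfolding d_def by (rule LeastI_ex)
    moreover have "u \<noteq> r"
      using that by simp
    ultimately obtain m where m: "d u = Suc m"
      by (cases "d u") auto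
    obtain v where v: "(u, v) \<in> adj V F" "(v, r) \<in> adj V F ^^ m"
      using relpow_Suc_D2[OF du[unfolded m]] by blast
    then have "d v \<le> m"
      unfolding d_def by (intro Least_le)
    then show ?thesis
      using v m by auto
  qed
  then obtain \<pi> where \<pi>: "\<And>u. u \<in> V - {r} \<Longrightarrow> {u, \<pi> u} \<in> F \<and> \<pi> u \<in> V \<and> d (\<pi> u) < d u"
    by metis
  let ?F = "(\<lambda>u. {u, \<pi> u}) ` (V - {r})"
  have rooted: "rooted_tree V r \<pi> ?F"
    using \<pi> assms(2) by (auto simp: rooted_tree_def)
  have "F \<subseteq> ?F"
  proof (rule subsetI, rule ccontr)
    fix e assume e: "e \<in> F" "e \<notin> ?F"
    then obtain a b where ab: "e = {a, b}" "a \<noteq> b" "a \<in> V" "b \<in> V"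
      using edges[OF e(1)] by (auto simp: card_2_iff)
    obtain q where q: "graph_path V ?F q" "hd q = a" "last q = b"
      using rooted_tree_connected[OF rooted] ab(3,4) unfolding graph_connected_def by blast
    obtain p where p: "graph_path V ?F p" "hd p = a" "last p = b" "distinct p"
      using graph_path_distinct[OF q(1)] q(2,3) by blast
    \<comment> \<open>A path of two vertices would make \<open>e\<close> itself a parent
      edge.\<close>
    have "length p \<ge> 3"
    proof (rule ccontr)
      assume short: "\<not> length p \<ge> 3"
      obtain c p' where c: "p = c # p'"
        using p(1) by (cases p) (auto simp: graph_path_def)
      then obtain d p'' where d: "p' = d # p''"
        using p(2,3) ab(2) by (cases p') auto
      then have "p'' = []"
        using c short by (cases p'') auto
      then have "{a, b} \<in> ?F"
        using p c d by (simp add: graph_path_def)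
      then show False
        using e(2) ab(1) by blast
    qed
    moreover have "successively (\<lambda>u v. {u, v} \<in> F) p"
    proof (rule successively_mono)
      show "successively (\<lambda>u v. {u, v} \<in> ?F) p"
        using p(1) by (simp add: graph_path_def)
    next
      fix u v assume "{u, v} \<in> ?F"
      then obtain c where c: "c \<in> V - {r}" "{u, v} = {c, \<pi> c}"
        by blast
      show "{u, v} \<in> F"
        unfolding c(2) using \<pi>[OF c(1)] by (rule conjunct1)
    qed
    moreover have "{last p, hd p} \<in> F"
      using e(1) unfolding p(2,3) ab(1) by (subst insert_commute)
    ultimately have "graph_cycle V F p"
      using p(1,4) unfolding graph_cycle_def graph_path_def by blast
    then show False
      using acyclic by blast
  qed
  moreover have "?F \<subseteq> F"
    using \<pi> by (intro image_subsetI) simp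
  ultimately have "?F = F"
    by (intro subset_antisym)
  then have "rooted_tree V r \<pi> F"
    using rooted by (simp only:)
  then show ?thesis
    by blast
qed

text \<open>The choice is harmless: off the root it is determined, by
  \<open>rooted_tree_unique\<close>.\<close>

definition parent :: "'a set \<Rightarrow> 'a \<Rightarrow> 'a set set \<Rightarrow> 'a \<Rightarrow> 'a" where
  "parent V r F = (SOME \<pi>. rooted_tree V r \<pi> F)"

lemma rooted_tree_parent_fun:
  assumes "is_tree V F" "r \<in> V"
  shows "rooted_tree V r (parent V r F) F"
  unfolding parent_def by (rule someI_ex[OF is_tree_imp_rooted_tree[OF assms]])

lemma is_tree_exit_tree: "p \<noteq> [] \<Longrightarrow> is_tree (set p) (exit_tree p)"
  using rooted_tree_imp_is_tree[OF exit_tree_rooted] by blast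

section \<open>Reversal of walks\<close>

text \<open>With \<open>parent\<close> in place of \<open>last_exit\<close>, the stacks depend only
  on the excess, the end point and the unoriented tree. Excess and tree are what a walk shares with
  its reversal.\<close>

lemma exits_eq_excess_parent:
  assumes "set p = V" "u \<in> V"
  shows "exits p u =
    excess p u @ (if u = last p then [] else [parent V (last p) (exit_tree p) u])"
proof (cases "u = last p")
  case False
  have "p \<noteq> []"
    using assms by auto
  with assms(1) have p: "p \<noteq> []" "last p \<in> V"
    by auto
  have "is_tree V (exit_tree p)"
    using is_tree_exit_tree[OF p(1)] assms(1) by simp
  then have "rooted_tree V (last p) (parent V (last p) (exit_tree p)) (exit_tree p)"
    using p(2) by (rule rooted_tree_parent_fun)
  then have "last_exit p u = parent V (last p) (exit_tree p) u"
    using exit_tree_rooted[OF assms(1) p(1)] False assms(2)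
    by (intro rooted_tree_unique[of V "last p" _ "exit_tree p"]) auto
  then show ?thesis
    using exits_eq_excess[of u p] assms False by simp
qed (simp add: excess_def)

lemma exits_outside: "u \<notin> set p \<Longrightarrow> exits p u = []"
  by (auto simp: exits_eq_Nil_iff dest: in_set_butlastD)

lemma excess_inject:
  assumes "p \<noteq> []" "set p = set q" "hd p = hd q" "last p = last q"
    and "exit_tree p = exit_tree q" "excess p = excess q"
  shows "p = q"
proof -
  have "exits p u = exits q u" for u
  proof (cases "u \<in> set p")
    case True
    then show ?thesis
      using exits_eq_excess_parent[of p "set p" u] exits_eq_excess_parent[of q "set p" u] assms
      by simp
  qed (use assms(2) in \<open>simp add: exits_outside\<close>)
  moreover have "q \<noteq> []"
    using assms(1,2) by auto
  ultimately show ?thesis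
    using assms(1,3) by (intro exits_inject) auto
qed

text \<open>In terms of excess stacks and the unrooted tree \<open>F\<close>, the flow condition of a walk from
  \<open>x\<close> to \<open>y\<close> is symmetric in \<open>x\<close> and \<open>y\<close>.\<close>

lemma balance_iff_excess:
  assumes "rooted_tree V y \<pi> F" "finite V" "v \<in> V"
    and s: "\<And>u. u \<in> V \<Longrightarrow> s u = e u @ (if u = y then [] else [\<pi> u])"
  shows "length (s v) + of_bool (v = y) = (\<Sum>u\<in>V. count_list (s u) v) + of_bool (v = x) \<longleftrightarrow>
    length (e v) + 2 =
      (\<Sum>u\<in>V. count_list (e u) v) + card {f \<in> F. v \<in> f} + of_bool (v = x) + of_bool (v = y)"
proof -
  have "(\<Sum>u\<in>V. count_list (s u) v) =
      (\<Sum>u\<in>V. count_list (e u) v + of_bool (u \<noteq> y \<and> \<pi> u = v))"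
    by (intro sum.cong) (auto simp: s)
  also have "\<dots> = (\<Sum>u\<in>V. count_list (e u) v) + card {u \<in> V - {y}. \<pi> u = v}"
  proof -
    have "V \<inter> {u. u \<noteq> y \<and> \<pi> u = v} = {u \<in> V - {y}. \<pi> u = v}"
      by auto
    then show ?thesis
      using assms(2) by (simp add: sum.distrib sum_of_bool_eq)
  qed
  finally have "(\<Sum>u\<in>V. count_list (s u) v) =
    (\<Sum>u\<in>V. count_list (e u) v) + card {u \<in> V - {y}. \<pi> u = v}" .
  moreover have "length (s v) + of_bool (v = y) = length (e v) + 1"
    using s[OF assms(3)] by auto
  ultimately show ?thesis
    using rooted_tree_degree[OF assms(1-3)] by linarith
qed

text \<open>The excess of \<open>p\<close>, completed by the parents in \<open>exit_tree p\<close>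
  directed towards \<open>hd p\<close>, satisfies the flow condition with the end points swapped.
  The rank of the redirected tree then lets \<open>exits_surj\<close> produce the walk.\<close>

lemma reversed_walk_exists:
  assumes "p \<noteq> []"
  shows "\<exists>q. q \<noteq> [] \<and> set q = set p \<and> hd q = last p \<and> last q = hd p \<and>
    exit_tree q = exit_tree p \<and> excess q = excess p"
proof -
  let ?V = "set p" and ?x = "hd p" and ?y = "last p" and ?F = "exit_tree p" and ?e = "excess p"
  define s where "s u = (if u \<in> ?V then ?e u @ (if u = ?x then [] else [parent ?V ?x ?F u]) else [])"
    for u
  have ends: "?x \<in> ?V" "?y \<in> ?V"
    using assms by auto
  have tree: "is_tree ?V ?F"
    using assms by (rule is_tree_exit_tree)
  note rooted_x = rooted_tree_parent_fun[OF tree ends(1)]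
  note rooted_y = rooted_tree_parent_fun[OF tree ends(2)]
  obtain h :: "'a \<Rightarrow> nat" where h: "\<And>u. u \<in> ?V - {?x} \<Longrightarrow> h (parent ?V ?x ?F u) < h u"
    using rooted_x unfolding rooted_tree_def by blast
  have excess_sub: "set (?e u) \<subseteq> ?V" for u
    using set_exits_subset[of p u] by (auto simp: excess_def dest: in_set_butlastD)
  have "\<exists>q. q \<noteq> [] \<and> set q \<subseteq> ?V \<and> hd q = ?y \<and> last q = ?x \<and> exits q = s"
  proof (rule exits_surj[where h = h])
    show "set (s u) \<subseteq> ?V" for u
      using excess_sub[of u] rooted_tree_parent(1)[OF rooted_x, of u] by (auto simp: s_def)
    show "length (s v) + of_bool (v = ?x) = (\<Sum>u\<in>?V. count_list (s u) v) + of_bool (v = ?y)"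
      if "v \<in> ?V" for v
    proof -
      have "length (exits p v) + of_bool (v = ?y) =
          (\<Sum>u\<in>?V. count_list (exits p u) v) + of_bool (v = ?x)"
        using count_list_eq_length_exits[OF assms, of v]
          count_list_eq_sum_exits[OF _ assms order_refl, of v] by simp
      then have "length (?e v) + 2 =
        (\<Sum>u\<in>?V. count_list (?e u) v) + card {f \<in> ?F. v \<in> f} + of_bool (v = ?x) + of_bool (v = ?y)"
        using balance_iff_excess[OF rooted_y _ that, of "exits p" ?e ?x]
          exits_eq_excess_parent[of p ?V] by simp
      then show ?thesis
        using balance_iff_excess[OF rooted_x _ that, of s ?e ?y] by (simp add: s_def)
    qed
  qed (use ends h in \<open>auto simp: s_def\<close>)
  then obtain q where q: "q \<noteq> []" "set q \<subseteq> ?V" "hd q = ?y" "last q = ?x" "exits q = s"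
    by blast
  \<comment> \<open>The stack of every vertex other than \<open>hd p\<close> holds at least its
    parent, and \<open>hd p\<close> is the end point of \<open>q\<close>; so nothing is left
    out.\<close>
  have "v \<in> set q" if "v \<in> ?V" for v
  proof -
    have "count_list q v \<noteq> 0"
      using count_list_eq_length_exits[OF q(1), of v] that unfolding q(4,5) by (auto simp: s_def)
    then show ?thesis
      by (simp add: count_list_0_iff)
  qed
  then have set_q: "set q = ?V"
    using q(2) by blast
  have "exit_tree q = (\<lambda>u. {u, parent ?V ?x ?F u}) ` (?V - {?x})"
    unfolding exit_tree_def[of q] set_q q(4)
    by (intro image_cong) (auto simp: last_exit_def[of q] q(5) s_def)
  also have "\<dots> = ?F"
    using rooted_tree_edges[OF rooted_x] by (rule sym)
  finally have "exit_tree q = ?F" .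
  moreover have "excess q u = ?e u" for u
    by (cases "u \<in> ?V") (auto simp: excess_def[of q] q(4,5) s_def excess_def[of p] exits_outside)
  ultimately show ?thesis
    using q set_q by blast
qed

lemma mset_eq_if_excess_eq:
  assumes "set p = set q" "excess p = excess q"
  shows "mset p = mset q"
proof (rule multiset_eqI)
  show "count (mset p) u = count (mset q) u" for u
    using count_list_eq_length_excess[of u p] count_list_eq_length_excess[of u q] assms
    by (cases "u \<in> set p") (auto simp: count_mset)
qed

text \<open>These are the possible trajectories up to the cover time: stopping when the range first
  becomes \<open>V\<close> means that the last vertex is new.\<close>

definition first_cover :: "'a set \<Rightarrow> 'a list \<Rightarrow> bool" where
  "first_cover V p \<longleftrightarrow> p \<noteq> [] \<and> set p = V \<and> last p \<notin> set (butlast p)"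

lemma first_cover_append: "first_cover V q \<Longrightarrow> first_cover V (q @ r) \<Longrightarrow> r = []"
  by (cases r rule: rev_cases) (auto simp: first_cover_def butlast_append)

text \<open>That \<open>last p\<close> is visited only once is expressed by its empty excess, and
  \<open>q\<close> inherits this.\<close>

lemma first_cover_rev:
  assumes "first_cover V p" "set q = set p" "excess q = excess p" "hd q = last p"
  shows "first_cover V (rev q)"
proof -
  have q: "q \<noteq> []"
    using assms by (auto simp: first_cover_def)
  have "excess p (last p) = []"
    using assms(1) by (auto simp: excess_def first_cover_def exits_eq_Nil_iff)
  then have "count_list q (hd q) = 1"
    using count_list_eq_length_excess[of "hd q" q] hd_in_set[OF q] assms by simp
  then have "hd q \<notin> set (tl q)"
    using q by (cases q) (auto simp: count_list_0_iff)
  then show ?thesis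
    using q assms by (cases q) (auto simp: first_cover_def)
qed

text \<open>The probability of the walk given its start: one factor per step, hence none for the
  final vertex.\<close>

definition walk_weight :: "'a set \<Rightarrow> 'a set set \<Rightarrow> 'a list \<Rightarrow> real" where
  "walk_weight V E p = (\<Prod>u\<leftarrow>butlast p. 1 / real (graph_degree V E u))"

text \<open>The weight depends only on the multiset of vertices with the final one removed, and both
  walks end at \<open>last p\<close>.\<close>

lemma walk_weight_rev:
  assumes "p \<noteq> []" "mset q = mset p" "hd q = last p"
  shows "walk_weight V E (rev q) = walk_weight V E p"
proof -
  have q: "q \<noteq> []"
    using assms by auto
  have "mset (tl q) = mset q - {#hd q#}"
    using q by (cases q) auto
  moreover have "mset (butlast p) = mset p - {#last p#}"
    using assms(1) by (cases p rule: rev_cases) auto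
  ultimately have "mset (rev (tl q)) = mset (butlast p)"
    using assms by simp
  moreover have "butlast (rev q) = rev (tl q)"
    using q by (cases q) auto
  moreover have "walk_weight V E r =
      (\<Prod>u\<in>#mset (butlast r). 1 / real (graph_degree V E u))" for r
    by (simp add: walk_weight_def flip: prod_mset_prod_list)
  ultimately show ?thesis
    by simp
qed

section \<open>The Aldous-Broder inequality\<close>

text \<open>The list is read from its end: each step moves the root from \<open>z\<close> to
  \<open>x\<close> and makes \<open>x\<close> the parent of \<open>z\<close>. Once the list covers,
  the parent of every vertex but the root is the predecessor of its first occurrence, whatever the
  initial \<open>\<pi>\<close> was.\<close>

fun first_entry_parent :: "'a list \<Rightarrow> ('a \<Rightarrow> 'a) \<Rightarrow> 'a \<Rightarrow> 'a" where
  "first_entry_parent (x # z # q) \<pi> = (first_entry_parent (z # q) \<pi>)(z := x)"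
| "first_entry_parent _ \<pi> = \<pi>"

text \<open>Each exit overwrites the previous parent, so the last exit of \<open>rev q\<close>
  survives. Vertices that are never left keep their initial parent.\<close>

lemma first_entry_parent_eq:
  assumes "q \<noteq> []"
  shows "first_entry_parent q \<pi> u =
    (if exits (rev q) u = [] then \<pi> u else last_exit (rev q) u)"
  using assms
proof (induction q rule: list_nonempty_induct)
  case (cons x q)
  then obtain z r where "q = z # r"
    by (cases q) auto
  then show ?case
    using cons.IH exits_snoc[of "rev q" x u] by (auto simp: last_exit_def)
qed simp

locale connected_graph =
  fixes V :: "'a set" and E :: "'a set set"
  assumes graph: "finite_simple_graph V E" and connected: "graph_connected V E"
begin

lemma finite_V: "finite V" and V_nonempty: "V \<noteq> {}"
  using graph by (auto simp: finite_simple_graph_def)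

lemma edgeD: "{u, v} \<in> E \<Longrightarrow> u \<in> V \<and> v \<in> V \<and> u \<noteq> v"
  using graph by (fastforce simp: finite_simple_graph_def)

abbreviation "spanning \<equiv> spanning_trees V E"
abbreviation "weight \<equiv> walk_weight V E"
abbreviation "deg \<equiv> graph_degree V E"
abbreviation "nb x \<equiv> {y \<in> V. {x, y} \<in> E}"

lemma finite_trees: "finite spanning"
proof (rule finite_subset)
  show "spanning \<subseteq> Pow (Pow V)"
    using graph by (auto simp: spanning_trees_def finite_simple_graph_def)
qed (use finite_V in simp)

lemma tree_rooted: "t \<in> spanning \<Longrightarrow> r \<in> V \<Longrightarrow> rooted_tree V r (parent V r t) t"
  by (rule rooted_tree_parent_fun) (simp_all add: spanning_trees_def)

lemma rooted_in_trees: "rooted_tree V r \<pi> t \<Longrightarrow> t \<subseteq> E \<Longrightarrow> t \<in> spanning"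
  using rooted_tree_imp_is_tree finite_V by (auto simp: spanning_trees_def)

lemma parent_edge:
  assumes "t \<in> spanning" "r \<in> V" "u \<in> V - {r}"
  shows "parent V r t u \<in> nb u"
  using rooted_tree_parent[OF tree_rooted[OF assms(1,2)] assms(3)] assms(1)
  by (auto simp: spanning_trees_def)

text \<open>The parent of \<open>x\<close> in a predecessor tree determines the predecessor: its root \<open>z\<close> is the
  child of \<open>x\<close> whose branch contains that parent.\<close>

lemma step_inject:
  assumes t: "t1 \<in> spanning" "t2 \<in> spanning"
    and z: "z1 \<in> V" "z2 \<in> V" "x \<noteq> z1" "x \<noteq> z2" "x \<in> V"
    and step: "rooted_tree V x ((parent V z1 t1)(z1 := x)) t"
      "rooted_tree V x ((parent V z2 t2)(z2 := x)) t"
    and eq: "parent V z1 t1 x = parent V z2 t2 x"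
  shows "z1 = z2 \<and> t1 = t2"
proof -
  let ?\<pi>1 = "parent V z1 t1" and ?\<pi>2 = "parent V z2 t2"
  note rooted1 = tree_rooted[OF t(1) z(1)] and rooted2 = tree_rooted[OF t(2) z(2)]
  have same: "(?\<pi>1(z1 := x)) u = (?\<pi>2(z2 := x)) u" if "u \<in> V - {x}" for u
    using step that by (rule rooted_tree_unique)
  obtain h1 :: "'a \<Rightarrow> nat" where h1: "\<And>u. u \<in> V - {z1} \<Longrightarrow> ?\<pi>1 u \<in> V \<and> h1 (?\<pi>1 u) < h1 u"
    using rooted1 unfolding rooted_tree_def by blast
  obtain h2 :: "'a \<Rightarrow> nat" where h2: "\<And>u. u \<in> V - {z2} \<Longrightarrow> ?\<pi>2 u \<in> V \<and> h2 (?\<pi>2 u) < h2 u"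
    using rooted2 unfolding rooted_tree_def by blast
  have "z1 = z2"
  proof (rule ccontr)
    assume ne: "z1 \<noteq> z2"
    \<comment> \<open>Infinite descent along the branch from the common parent of \<open>x\<close>.
      It lies below \<open>x\<close> in both ranks, so it avoids \<open>z1\<close> and
      \<open>z2\<close>: each of them has \<open>x\<close> as parent in the other tree. Hence the
      parent functions agree along it and never stop descending.\<close>
    let ?P = "\<lambda>u. u \<in> V \<and> h1 u < h1 x \<and> h2 u < h2 x"
    have "?P (?\<pi>1 x)"
      using h1[of x] h2[of x] z eq by simp
    then obtain u where u: "?P u" and min: "\<And>v. ?P v \<Longrightarrow> h1 u \<le> h1 v"
      using ex_has_least_nat[of ?P _ h1] by blast
    have "?\<pi>2 z1 = x" "?\<pi>1 z2 = x"
      using same[of z1] same[of z2] z ne by auto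
    then have u12: "u \<noteq> z1" "u \<noteq> z2" "u \<noteq> x"
      using u h1[of z2] h2[of z1] z ne by auto
    then have "?P (?\<pi>1 u)" "h1 (?\<pi>1 u) < h1 u"
      using same[of u] u h1[of u] h2[of u] by auto
    then show False
      using min[of "?\<pi>1 u"] by simp
  qed
  moreover have "t1 = t2"
  proof -
    have "?\<pi>1 u = ?\<pi>2 u" if "u \<in> V - {z1}" for u
      using same[of u] eq that \<open>z1 = z2\<close> by (cases "u = x") auto
    then have "rooted_tree V z1 ?\<pi>2 t1"
      using rooted1 rooted_tree_cong[of V z1 ?\<pi>1 ?\<pi>2 t1] by blast
    then show ?thesis
      using rooted2 \<open>z1 = z2\<close> by (auto dest!: rooted_tree_edges)
  qed
  ultimately show ?thesis ..
qed

section \<open>Counting initial trees along a walk\<close>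

definition predecessors :: "'a \<Rightarrow> 'a set set \<Rightarrow> 'a \<Rightarrow> 'a set set set" where
  "predecessors x t z = {t' \<in> spanning. rooted_tree V x ((parent V z t')(z := x)) t}"

text \<open>Mapping a predecessor \<open>(z, t')\<close> to the parent of \<open>x\<close> in
  \<open>t'\<close> is injective by \<open>step_inject\<close> and lands among the neighbours of
  \<open>x\<close>.\<close>

lemma card_predecessors_le:
  assumes "x \<in> V"
  shows "(\<Sum>z\<in>nb x. card (predecessors x t z)) \<le> deg x"
proof -
  have fin: "finite (predecessors x t z)" for z
    using finite_trees by (simp add: predecessors_def)
  have ne: "z \<noteq> x" if "z \<in> nb x" for z
    using that edgeD[of x z] by auto
  have "card (SIGMA z:nb x. predecessors x t z) \<le> card (nb x)"
  proof (rule card_inj_on_le[where f = "\<lambda>(z, t'). parent V z t' x"])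
    show "inj_on (\<lambda>(z, t'). parent V z t' x) (SIGMA z:nb x. predecessors x t z)"
    proof (rule inj_onI, clarify)
      fix z1 t1 z2 t2
      assume *: "z1 \<in> V" "{x, z1} \<in> E" "t1 \<in> predecessors x t z1"
        "z2 \<in> V" "{x, z2} \<in> E" "t2 \<in> predecessors x t z2"
        "parent V z1 t1 x = parent V z2 t2 x"
      then show "z1 = z2 \<and> t1 = t2"
        using ne[of z1] ne[of z2] assms
        by (intro step_inject[where x = x and t = t]) (auto simp: predecessors_def)
    qed
    show "(\<lambda>(z, t'). parent V z t' x) ` (SIGMA z:nb x. predecessors x t z) \<subseteq> nb x"
    proof clarify
      fix z t' assume "z \<in> V" "{x, z} \<in> E" "t' \<in> predecessors x t z"
      then show "parent V z t' x \<in> V \<and> {x, parent V z t' x} \<in> E"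
        using parent_edge[of t' z x] ne[of z] assms by (auto simp: predecessors_def)
    qed
  qed (use finite_V in simp)
  then show ?thesis
    using finite_V fin by (simp add: graph_degree_def)
qed

text \<open>The initial trees from which the first-entry dynamics along \<open>rev p\<close> produces \<open>t\<close>.\<close>

definition sources :: "'a list \<Rightarrow> 'a set set \<Rightarrow> 'a set set set" where
  "sources p t =
    {t' \<in> spanning. rooted_tree V (hd p) (first_entry_parent p (parent V (last p) t')) t}"

lemma finite_sources: "finite (sources p t)"
  using finite_trees by (simp add: sources_def)

text \<open>A covering walk forgets the initial tree, so every spanning tree is a source.\<close>

lemma sources_covering:
  assumes "p \<noteq> []" "set p = V" "exit_tree (rev p) = t"
  shows "sources p t = spanning"
proof -
  have "rooted_tree V (hd p) (first_entry_parent p \<pi>) t" for \<pi>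
  proof -
    have "first_entry_parent p \<pi> u = last_exit (rev p) u" if "u \<in> V - {hd p}" for u
      using exits_nonempty[of u "rev p"] that assms
      by (simp add: first_entry_parent_eq last_rev)
    moreover have "rooted_tree V (hd p) (last_exit (rev p)) t"
      using exit_tree_rooted[of "rev p" V] assms by (simp add: last_rev)
    ultimately show ?thesis
      using rooted_tree_cong[of V "hd p" "first_entry_parent p \<pi>" "last_exit (rev p)" t] by blast
  qed
  then show ?thesis
    by (simp add: sources_def)
qed

lemma first_entry_tree_exists:
  assumes "graph_path V E q" "rooted_tree V (last q) \<pi> t" "t \<subseteq> E"
  shows "\<exists>F\<subseteq>E. rooted_tree V (hd q) (first_entry_parent q \<pi>) F"
proof -
  have "q \<noteq> []"
    using assms by (auto simp: graph_path_def)
  then show ?thesis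
    using assms(1,2)
  proof (induction q rule: list_nonempty_induct)
    case (single x)
    then show ?case
      using assms(3) by auto
  next
    case (cons x q)
    obtain z r where q: "q = z # r"
      using cons.hyps by (cases q) auto
    obtain F where F: "F \<subseteq> E" "rooted_tree V z (first_entry_parent q \<pi>) F"
      using cons q by (auto simp: graph_path_def)
    have xz: "{x, z} \<in> E"
      using cons.prems q by (auto simp: graph_path_def)
    let ?\<rho> = "(first_entry_parent q \<pi>)(z := x)"
    have rooted: "rooted_tree V x ?\<rho> ((\<lambda>u. {u, ?\<rho> u}) ` (V - {x}))"
      using rooted_tree_step[OF F(2)] edgeD[OF xz] by blast
    have "{u, ?\<rho> u} \<in> E" if "u \<in> V - {x}" for u
    proof (cases "u = z")
      case True
      then show ?thesis
        using xz by (simp add: insert_commute)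
    next
      case False
      then show ?thesis
        using rooted_tree_parent(3)[OF F(2), of u] F(1) that by auto
    qed
    then have sub: "(\<lambda>u. {u, ?\<rho> u}) ` (V - {x}) \<subseteq> E"
      by blast
    have eq: "first_entry_parent (x # q) \<pi> = ?\<rho>"
      by (simp add: q)
    show ?case
      unfolding list.sel eq using rooted sub by blast
  qed
qed

text \<open>Peel off the final update, from \<open>hd q\<close> to \<open>x\<close>. The tree just
  before it is a predecessor of \<open>t\<close>, and the initial tree is a source of that tree
  along \<open>q\<close>.\<close>

lemma card_sources_Cons:
  assumes path: "graph_path V E (x # q)" and q: "q \<noteq> []"
  shows "card (sources (x # q) t) \<le> (\<Sum>t'\<in>predecessors x t (hd q). card (sources q t'))"
proof -
  obtain z r where zr: "q = z # r"
    using q by (cases q) auto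
  have path_q: "graph_path V E q" and xz: "{x, z} \<in> E"
    using path by (auto simp: zr graph_path_def)
  have last_q: "last q \<in> V"
    using path_q last_in_set[OF q] by (auto simp: graph_path_def)
  have "sources (x # q) t \<subseteq> (\<Union>t'\<in>predecessors x t z. sources q t')"
  proof
    fix t0 assume "t0 \<in> sources (x # q) t"
    then have t0: "t0 \<in> spanning"
      and step: "rooted_tree V x ((first_entry_parent q (parent V (last q) t0))(z := x)) t"
      by (auto simp: sources_def zr)
    let ?\<rho> = "first_entry_parent q (parent V (last q) t0)"
    obtain F where F: "F \<subseteq> E" "rooted_tree V z ?\<rho> F"
      using first_entry_tree_exists[OF path_q tree_rooted[OF t0 last_q]] t0
      by (auto simp: spanning_trees_def zr)
    have FT: "F \<in> spanning"
      using F by (auto intro: rooted_in_trees)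
    have "?\<rho> u = parent V z F u" if "u \<in> V - {z}" for u
      using F(2) tree_rooted[OF FT, of z] edgeD[OF xz] that by (intro rooted_tree_unique) auto
    then have "(?\<rho>(z := x)) u = ((parent V z F)(z := x)) u" if "u \<in> V - {x}" for u
      using that by simp
    then have "rooted_tree V x ((parent V z F)(z := x)) t"
      using step rooted_tree_cong[of V x "?\<rho>(z := x)" "(parent V z F)(z := x)" t] by blast
    then have "F \<in> predecessors x t z"
      using FT by (simp add: predecessors_def)
    moreover have "t0 \<in> sources q F"
      using t0 F(2) by (simp add: sources_def zr)
    ultimately show "t0 \<in> (\<Union>t'\<in>predecessors x t z. sources q t')"
      by blast
  qed
  moreover have fin: "finite (predecessors x t z)"
    using finite_trees by (simp add: predecessors_def)
  ultimately have "card (sources (x # q) t) \<le> card (\<Union>t'\<in>predecessors x t z. sources q t')"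
    using finite_sources by (intro card_mono) auto
  also have "\<dots> \<le> (\<Sum>t'\<in>predecessors x t z. card (sources q t'))"
    using fin by (rule card_UN_le)
  finally show ?thesis
    by (simp add: zr)
qed

lemma card_sources_single: "x \<in> V \<Longrightarrow> card (sources [x] t) \<le> 1"
proof -
  assume "x \<in> V"
  then have "sources [x] t \<subseteq> {t}"
    using tree_rooted by (auto simp: sources_def dest!: rooted_tree_edges)
  then show ?thesis
    using card_mono[of "{t}"] by simp
qed

lemma weight_Cons: "q \<noteq> [] \<Longrightarrow> weight (x # q) = weight q / real (deg x)"
  by (simp add: walk_weight_def)

lemma weight_nonneg: "weight p \<ge> 0"
  unfolding walk_weight_def by (intro prod_list_nonneg) auto

text \<open>The sum is an expected number of initial trees leading to \<open>t\<close>. Splitting by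
  the first step gives a factor \<open>1 / deg x\<close> and replaces \<open>t\<close> by its
  predecessors. There are at most \<open>deg x\<close> of these in total, and each contributes at
  most 1 by induction; this is why \<open>t\<close> is generalised.\<close>

lemma prefix_free_bound:
  assumes "finite C" "\<And>p. p \<in> C \<Longrightarrow> graph_path V E p \<and> hd p = x"
    and "\<And>q r. q \<in> C \<Longrightarrow> q @ r \<in> C \<Longrightarrow> r = []" and "x \<in> V"
  shows "(\<Sum>p\<in>C. weight p * card (sources p t)) \<le> 1"
proof -
  obtain n where "\<forall>p\<in>C. length p \<le> n"
    using assms(1) by (meson finite_nat_set_iff_bounded_le finite_imageI imageI)
  then show ?thesis
    using assms
  proof (induction n arbitrary: C x t)
    case 0
    then have "C = {}"
      by (auto simp: graph_path_def)
    then show ?case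
      by simp
  next
    case (Suc n)
    note fin = Suc.prems(2) and path = Suc.prems(3) and pf = Suc.prems(4) and x = Suc.prems(5)
    show ?case
    proof (cases "[x] \<in> C")
      case True
      \<comment> \<open>Prefix-freeness leaves no room for a longer walk beside
        \<open>[x]\<close>.\<close>
      have "p = [x]" if p: "p \<in> C" for p
      proof -
        obtain r where r: "p = [x] @ r"
          using path[OF p] by (cases p) (auto simp: graph_path_def)
        then show ?thesis
          using pf[OF True, of r] p by simp
      qed
      then have "C = {[x]}"
        using True by blast
      then show ?thesis
        using card_sources_single[OF x, of t] by (simp add: walk_weight_def)
    next
      case False
      define D where "D z = {q. x # q \<in> C \<and> q \<noteq> [] \<and> hd q = z}" for z
      have D_fin: "finite (D z)" for z
      proof (rule finite_subset)
        show "D z \<subseteq> tl ` C"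
          by (force simp: D_def)
      qed (use fin in simp)
      have CD: "C = (#) x ` (\<Union>z\<in>nb x. D z)"
      proof (intro set_eqI iffI)
        fix p assume p: "p \<in> C"
        then obtain q where q: "p = x # q"
          using path[OF p] by (cases p) (auto simp: graph_path_def)
        moreover have "q \<noteq> []"
          using False p q by auto
        moreover have "hd q \<in> nb x"
          using path[OF p] q \<open>q \<noteq> []\<close> by (cases q) (auto simp: graph_path_def)
        ultimately show "p \<in> (#) x ` (\<Union>z\<in>nb x. D z)"
          using p by (auto simp: D_def)
      qed (auto simp: D_def)
      have bound: "(\<Sum>q\<in>D z. weight (x # q) * card (sources (x # q) t)) \<le>
          card (predecessors x t z) / deg x" if "z \<in> nb x" for z
      proof -
        have "(\<Sum>q\<in>D z. weight (x # q) * card (sources (x # q) t)) \<le>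
            (\<Sum>q\<in>D z. weight q / deg x * (\<Sum>t'\<in>predecessors x t z. card (sources q t')))"
        proof (intro sum_mono)
          fix q assume q: "q \<in> D z"
          then have "graph_path V E (x # q)" "q \<noteq> []" "hd q = z"
            using path by (auto simp: D_def)
          then show "weight (x # q) * card (sources (x # q) t) \<le>
              weight q / deg x * (\<Sum>t'\<in>predecessors x t z. card (sources q t'))"
            unfolding weight_Cons[OF \<open>q \<noteq> []\<close>]
            using card_sources_Cons[of x q t] weight_nonneg[of q]
            by (intro mult_left_mono) (auto simp flip: of_nat_sum simp del: of_nat_sum)
        qed
        also have "\<dots> = (\<Sum>t'\<in>predecessors x t z. \<Sum>q\<in>D z. weight q * card (sources q t')) / deg x"
          by (subst sum.swap) (simp add: sum_distrib_left sum_divide_distrib)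
        also have "\<dots> \<le> (\<Sum>t'\<in>predecessors x t z. 1) / deg x"
        proof (intro divide_right_mono sum_mono)
          fix t'
          show "(\<Sum>q\<in>D z. weight q * card (sources q t')) \<le> 1"
          proof (rule Suc.IH[where x = z])
            show "\<forall>q\<in>D z. length q \<le> n"
              using Suc.prems(1) by (auto simp: D_def)
            show "graph_path V E q \<and> hd q = z" if "q \<in> D z" for q
              using path[of "x # q"] that by (auto simp: D_def graph_path_def successively_Cons)
            show "r = []" if "q \<in> D z" "q @ r \<in> D z" for q r
              using pf[of "x # q" r] that by (auto simp: D_def)
          qed (use D_fin \<open>z \<in> nb x\<close> in auto)
        qed auto
        finally show ?thesis
          by simp
      qed
      have "(\<Sum>p\<in>C. weight p * card (sources p t)) =
          (\<Sum>q\<in>(\<Union>z\<in>nb x. D z). weight (x # q) * card (sources (x # q) t))"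
        unfolding CD by (subst sum.reindex) auto
      also have "\<dots> = (\<Sum>z\<in>nb x. \<Sum>q\<in>D z. weight (x # q) * card (sources (x # q) t))"
        using finite_V D_fin by (intro sum.UNION_disjoint) (auto simp: D_def)
      also have "\<dots> \<le> (\<Sum>z\<in>nb x. card (predecessors x t z) / deg x)"
        using bound by (intro sum_mono) auto
      also have "\<dots> = (\<Sum>z\<in>nb x. card (predecessors x t z)) / deg x"
        by (simp add: sum_divide_distrib)
      also have "\<dots> \<le> 1"
      proof -
        have "real (\<Sum>z\<in>nb x. card (predecessors x t z)) \<le> real (deg x)"
          using card_predecessors_le[OF x, of t] by (simp only: of_nat_le_iff)
        then show ?thesis
          by (cases "deg x = 0") (auto simp: divide_le_eq_1)
      qed
      finally show ?thesis .
    qed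
  qed
qed

section \<open>The bound for last-exit trees of covering walks\<close>

lemma graph_path_if_excess:
  assumes "q \<noteq> []" "set q = V" "exit_tree q \<subseteq> E" "\<And>u. \<forall>v\<in>set (excess q u). {u, v} \<in> E"
  shows "graph_path V E q"
proof -
  have "{u, v} \<in> E" if "v \<in> set (exits q u)" for u v
  proof -
    have u: "u \<in> V"
      using that exits_outside[of u q] assms(2) by auto
    show ?thesis
    proof (cases "v \<in> set (excess q u)")
      case False
      then have "u \<noteq> last q" "v = last_exit q u"
        using that exits_eq_excess[of u q] u assms(2) by (auto split: if_splits)
      then show ?thesis
        using assms(2,3) u by (auto simp: exit_tree_def)
    qed (use assms(4) in blast)
  qed
  then show ?thesis
    using assms(1,2) by (simp add: graph_path_def successively_iff_exits)
qed

lemma graph_path_exits: "graph_path V E p \<Longrightarrow> v \<in> set (exits p u) \<Longrightarrow> {u, v} \<in> E"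
  by (auto simp: graph_path_def successively_iff_exits)

lemma graph_path_excess: "graph_path V E p \<Longrightarrow> v \<in> set (excess p u) \<Longrightarrow> {u, v} \<in> E"
  by (auto simp: excess_def split: if_splits dest: in_set_butlastD graph_path_exits)

lemma exit_tree_in_trees:
  assumes "graph_path V E p" "set p = V"
  shows "exit_tree p \<in> spanning"
proof -
  have "{u, last_exit p u} \<in> E" if "u \<in> set p - {last p}" for u
    using graph_path_exits[OF assms(1), of "last_exit p u" u] exits_nonempty[OF that]
    by (simp add: last_exit_def)
  then have "exit_tree p \<subseteq> E"
    by (auto simp: exit_tree_def)
  moreover have "p \<noteq> []"
    using assms(1) by (simp add: graph_path_def)
  ultimately show ?thesis
    using exit_tree_rooted[OF assms(2)] rooted_in_trees by blast
qed

text \<open>Reversing the walks turns last exits into first entries, so that the Aldous-Broder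
  inequality applies.\<close>

lemma exit_tree_bound:
  assumes "finite D" "x \<in> V"
    and D: "\<And>p. p \<in> D \<Longrightarrow> graph_path V E p \<and> hd p = x \<and> first_cover V p \<and> exit_tree p = t"
  shows "(\<Sum>p\<in>D. weight p) * card spanning \<le> 1"
proof -
  have "\<forall>p\<in>D. \<exists>q. q \<noteq> [] \<and> set q = set p \<and> hd q = last p \<and> last q = hd p \<and>
      exit_tree q = exit_tree p \<and> excess q = excess p"
  proof
    fix p assume "p \<in> D"
    then have "p \<noteq> []"
      using D by (auto simp: first_cover_def)
    then show "\<exists>q. q \<noteq> [] \<and> set q = set p \<and> hd q = last p \<and> last q = hd p \<and>
        exit_tree q = exit_tree p \<and> excess q = excess p"
      by (rule reversed_walk_exists)
  qed
  \<comment> \<open>Each \<open>f p\<close> runs from \<open>last p\<close> to \<open>x\<close>, so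
    \<open>rev (f p)\<close> starts at \<open>x\<close> again. It is a first cover of the same
    weight, and all spanning trees are its sources.\<close>
  then obtain f where "\<forall>p\<in>D. f p \<noteq> [] \<and> set (f p) = set p \<and> hd (f p) = last p \<and>
      last (f p) = hd p \<and> exit_tree (f p) = exit_tree p \<and> excess (f p) = excess p"
    by metis
  then have f: "f p \<noteq> []" "set (f p) = V" "hd (f p) = last p" "last (f p) = x"
      "exit_tree (f p) = t" "excess (f p) = excess p" if "p \<in> D" for p
    using that D[OF that] by (auto simp: first_cover_def)
  have path: "graph_path V E (f p)" if "p \<in> D" for p
  proof (rule graph_path_if_excess)
    have "t \<in> spanning"
      using exit_tree_in_trees[of p] D[OF that] by (auto simp: first_cover_def)
    then show "exit_tree (f p) \<subseteq> E"
      using f(5)[OF that] by (simp add: spanning_trees_def)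
    show "\<forall>v\<in>set (excess (f p) u). {u, v} \<in> E" for u
      using D[OF that] graph_path_excess f(6)[OF that] by auto
  qed (use f[OF that] in auto)
  have cover: "first_cover V (rev (f p))" if "p \<in> D" for p
    using D[OF that] f[OF that] by (intro first_cover_rev[of V p]) (auto simp: first_cover_def)
  have inj: "inj_on (\<lambda>p. rev (f p)) D"
  proof (rule inj_onI)
    fix p q assume pq: "p \<in> D" "q \<in> D" "rev (f p) = rev (f q)"
    then have "f p = f q"
      by simp
    then show "p = q"
      using D[OF pq(1)] D[OF pq(2)] f[OF pq(1)] f[OF pq(2)]
      by (intro excess_inject) (auto simp: first_cover_def)
  qed
  have weight: "weight (rev (f p)) = weight p" if "p \<in> D" for p
    using D[OF that] f[OF that]
    by (intro walk_weight_rev mset_eq_if_excess_eq) (auto simp: first_cover_def)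
  have sources: "sources (rev (f p)) t = spanning" if "p \<in> D" for p
    using f[OF that] by (intro sources_covering) auto
  have "(\<Sum>p\<in>D. weight p) * card spanning =
      (\<Sum>p\<in>D. weight (rev (f p)) * card (sources (rev (f p)) t))"
    by (simp add: weight sources sum_distrib_right)
  also have "\<dots> = (\<Sum>q\<in>(\<lambda>p. rev (f p)) ` D. weight q * card (sources q t))"
    using inj by (simp add: sum.reindex)
  also have "\<dots> \<le> 1"
  proof (rule prefix_free_bound)
    show "graph_path V E q \<and> hd q = x" if q: "q \<in> (\<lambda>p. rev (f p)) ` D" for q
    proof -
      obtain p where p: "p \<in> D" "q = rev (f p)"
        using q by blast
      then show ?thesis
        using path[OF p(1)] f[OF p(1)]
        by (auto simp: graph_path_def hd_rev successively_rev insert_commute)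
    qed
    show "r = []" if "q \<in> (\<lambda>p. rev (f p)) ` D" "q @ r \<in> (\<lambda>p. rev (f p)) ` D" for q r
    proof -
      have "first_cover V q" "first_cover V (q @ r)"
        using that cover by (fast, metis (mono_tags, lifting) cover imageE)
      then show ?thesis
        by (rule first_cover_append)
    qed
  qed (use assms in auto)
  finally show ?thesis .
qed

end

section \<open>Last-exit trees of trajectories\<close>

lemma exits_map_upt:
  "exits (map x [0..<Suc n]) u = map (\<lambda>i. x (Suc i)) (filter (\<lambda>i. x i = u) [0..<n])"
proof (induction n)
  case (Suc n)
  have "exits (map x [0..<Suc n] @ [x (Suc n)]) u =
      exits (map x [0..<Suc n]) u @ (if u = x n then [x (Suc n)] else [])"
    by (subst exits_snoc) simp_all
  then show ?case
    using Suc by simp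
qed simp

lemma last_filter_upt:
  "\<exists>i<n. P i \<Longrightarrow> last (filter P [0..<n]) = Max {i. i < n \<and> P i}"
proof (induction n)
  case (Suc n)
  show ?case
  proof (cases "P n")
    case True
    then have "Max {i. i < Suc n \<and> P i} = n"
      by (intro Max_eqI) auto
    then show ?thesis
      using True by simp
  next
    case False
    then have "{i. i < Suc n \<and> P i} = {i. i < n \<and> P i}" "\<exists>i<n. P i"
      using Suc.prems by (auto simp: less_Suc_eq)
    then show ?thesis
      using Suc.IH False by simp
  qed
qed simp

text \<open>The bridge from times to lists: the entries of an exit stack are ordered by time, so the
  maximal exit time yields the last entry.\<close>

lemma last_exit_edges_eq: "last_exit_edges x n = exit_tree (map x [0..<Suc n])"
proof -
  let ?p = "map x [0..<Suc n]"
  have "last_exit_edge x n u = {u, last_exit ?p u}" if u: "u \<in> x ` {..n} - {x n}" for u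
  proof -
    let ?I = "{i. i < n \<and> x i = u}"
    obtain j where j: "j \<le> n" "x j = u" "j \<noteq> n"
      using u by auto
    then have ex: "\<exists>i<n. x i = u"
      by (metis le_neq_implies_less)
    then have "Max ?I \<in> ?I"
      by (intro Max_in) auto
    moreover have "last_exit ?p u = x (Suc (Max ?I))"
    proof -
      have "filter (\<lambda>i. x i = u) [0..<n] \<noteq> []"
        using ex by (auto simp: filter_empty_conv)
      then show ?thesis
        unfolding last_exit_def exits_map_upt by (simp add: last_map last_filter_upt[OF ex])
    qed
    ultimately show ?thesis
      by (simp add: last_exit_edge_def last_exit_index_def)
  qed
  moreover have "set ?p = x ` {..n}"
    by (simp only: set_map set_upt atLeast0LessThan lessThan_Suc_atMost)
  moreover have "last ?p = x n"
    by simp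
  ultimately show ?thesis
    unfolding last_exit_edges_def exit_tree_def by (metis (no_types, lifting) image_cong)
qed

lemma Inf_enat_eq_iff:
  "Inf {enat n |n. P n} = enat n \<longleftrightarrow> P n \<and> (\<forall>k<n. \<not> P k)"
proof
  assume *: "Inf {enat n |n. P n} = enat n"
  then have "{enat n |n. P n} \<noteq> {}"
    by (metis Inf_empty enat.distinct(1) top_enat_def)
  then have "Inf {enat n |n. P n} \<in> {enat n |n. P n}"
    unfolding Inf_enat_def by (auto intro: LeastI)
  moreover have "\<not> P k" if "k < n" for k
  proof
    assume "P k"
    then have "Inf {enat n |n. P n} \<le> enat k"
      by (intro Inf_lower) blast
    then show False
      using * that by simp
  qed
  ultimately show "P n \<and> (\<forall>k<n. \<not> P k)"
    using * by auto
next
  assume "P n \<and> (\<forall>k<n. \<not> P k)"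
  then show "Inf {enat n |n. P n} = enat n"
    by (intro antisym Inf_lower Inf_greatest) (auto simp: not_less[symmetric])
qed

text \<open>If the vertex at time \<open>n\<close> had occurred before, time \<open>n - 1\<close>
  would already cover; if it is new, no earlier range contains it.\<close>

lemma cover_time_eq_iff: "cover_time V x = enat n \<longleftrightarrow> first_cover V (map x [0..<Suc n])"
proof -
  have set: "set (map x [0..<Suc n]) = x ` {..n}"
    by (simp only: set_map set_upt atLeast0LessThan lessThan_Suc_atMost)
  have butlast: "set (butlast (map x [0..<Suc n])) = x ` {..<n}"
    by (simp add: atLeast0LessThan)
  have "x ` {..n} = V \<and> (\<forall>k<n. x ` {..k} \<noteq> V) \<longleftrightarrow> x ` {..n} = V \<and> x n \<notin> x ` {..<n}"
  proof (intro conj_cong refl iffI)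
    assume V: "x ` {..n} = V" and *: "\<forall>k<n. x ` {..k} \<noteq> V"
    show "x n \<notin> x ` {..<n}"
    proof
      assume rep: "x n \<in> x ` {..<n}"
      then obtain m where m: "n = Suc m"
        by (cases n) auto
      then have "x ` {..m} = V"
        using V rep by (auto simp: atMost_Suc lessThan_Suc_atMost)
      then show False
        using * m by auto
    qed
  next
    assume V: "x ` {..n} = V" and *: "x n \<notin> x ` {..<n}"
    then show "\<forall>k<n. x ` {..k} \<noteq> V"
      by (metis (no_types, lifting) atMost_iff image_iff lessThan_iff order_le_less_trans order_refl)
  qed
  then show ?thesis
    unfolding cover_time_def Inf_enat_eq_iff first_cover_def set butlast by simp
qed

text \<open>The probability that the walk from \<open>x\<close> misses \<open>v\<close> at all times
  from 0 to \<open>n\<close>, given by its first-step recursion so that its limit can be found from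
  the transition matrix alone.\<close>

primrec avoid_prob :: "'a set \<Rightarrow> 'a set set \<Rightarrow> 'a \<Rightarrow> nat \<Rightarrow> 'a \<Rightarrow> real" where
  "avoid_prob V E v 0 x = of_bool (x \<noteq> v)"
| "avoid_prob V E v (Suc n) x =
    of_bool (x \<noteq> v) * (\<Sum>z\<in>V. srw_prob V E x z * avoid_prob V E v n z)"

section \<open>The random walk\<close>

context connected_graph
begin

lemma deg_zero:
  assumes "x \<in> V" "deg x = 0"
  shows "V = {x}"
proof -
  have "y = x" if y: "y \<in> V" for y
  proof (rule ccontr)
    assume "y \<noteq> x"
    obtain p where p: "graph_path V E p" "hd p = x" "last p = y"
      using connected assms(1) y unfolding graph_connected_def by blast
    then obtain z r where "p = x # z # r"
      using \<open>y \<noteq> x\<close> by (cases p rule: remdups_adj.cases) (auto simp: graph_path_def)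
    then have "z \<in> nb x"
      using p(1) by (auto simp: graph_path_def)
    then show False
      using assms(2) finite_V by (auto simp: graph_degree_def card_eq_0_iff)
  qed
  then show ?thesis
    using assms(1) by blast
qed

lemma srw_prob_edge: "{x, y} \<in> E \<Longrightarrow> srw_prob V E x y = 1 / deg x"
  using edgeD[of x y] finite_V by (auto simp: srw_prob_def graph_degree_def card_eq_0_iff)

lemma srw_prob_nonneg: "srw_prob V E x y \<ge> 0"
  by (simp add: srw_prob_def)

lemma sum_srw_prob:
  assumes "x \<in> V"
  shows "(\<Sum>z\<in>V. srw_prob V E x z) = 1"
proof (cases "deg x = 0")
  case True
  then show ?thesis
    using assms finite_V by (simp add: srw_prob_def)
next
  case False
  have "V \<inter> {z. {x, z} \<in> E} = nb x"
    by auto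
  then have "(\<Sum>z\<in>V. if {x, z} \<in> E then 1 else 0 :: real) = deg x"
    using finite_V by (simp add: graph_degree_def flip: sum.inter_restrict)
      (simp add: sum.If_cases)
  then show ?thesis
    using False by (simp add: srw_prob_def flip: sum_divide_distrib)
qed

section \<open>Avoidance probabilities and their limit\<close>

abbreviation "avoid \<equiv> avoid_prob V E"

lemma avoid_bounds: "0 \<le> avoid v n x" "x \<in> V \<Longrightarrow> avoid v (Suc n) x \<le> avoid v n x"
proof -
  have nonneg: "0 \<le> avoid v n x" for n x
    by (induction n arbitrary: x) (auto intro!: sum_nonneg mult_nonneg_nonneg srw_prob_nonneg)
  then show "0 \<le> avoid v n x" .
  show "x \<in> V \<Longrightarrow> avoid v (Suc n) x \<le> avoid v n x"
  proof (induction n arbitrary: x)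
    case 0
    have "(\<Sum>z\<in>V. srw_prob V E x z * of_bool (z \<noteq> v)) \<le> (\<Sum>z\<in>V. srw_prob V E x z)"
      using srw_prob_nonneg[of x] by (intro sum_mono) auto
    then show ?case
      using sum_srw_prob[OF 0] by simp
  next
    case (Suc n)
    then have "(\<Sum>z\<in>V. srw_prob V E x z * avoid v (Suc n) z) \<le>
        (\<Sum>z\<in>V. srw_prob V E x z * avoid v n z)"
      by (intro sum_mono mult_left_mono srw_prob_nonneg) auto
    then show ?case
      by (simp only: avoid_prob.simps) (intro mult_left_mono, auto)
  qed
qed

text \<open>The limit is harmonic off \<open>v\<close> and vanishes at \<open>v\<close>, hence vanishes by the maximum principle.\<close>

lemma avoid_tendsto_0:
  assumes "v \<in> V" "x \<in> V"
  shows "(\<lambda>n. avoid v n x) \<longlonglongrightarrow> 0"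
proof -
  have "\<exists>l. (\<lambda>n. avoid v n z) \<longlonglongrightarrow> l" if "z \<in> V" for z
  proof -
    have "decseq (\<lambda>n. avoid v n z)"
      using avoid_bounds(2)[OF that] unfolding decseq_Suc_iff by blast
    moreover have "\<forall>n. 0 \<le> avoid v n z"
      using avoid_bounds(1) ..
    ultimately obtain l where "(\<lambda>n. avoid v n z) \<longlonglongrightarrow> l"
      by (rule decseq_convergent)
    then show ?thesis ..
  qed
  then obtain G where G: "\<And>z. z \<in> V \<Longrightarrow> (\<lambda>n. avoid v n z) \<longlonglongrightarrow> G z"
    by metis
  have harmonic: "G z = of_bool (z \<noteq> v) * (\<Sum>w\<in>V. srw_prob V E z w * G w)" if "z \<in> V" for z
  proof (rule LIMSEQ_unique)
    show "(\<lambda>n. avoid v (Suc n) z) \<longlonglongrightarrow> G z"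
      using G[OF that] by (rule LIMSEQ_Suc)
    show "(\<lambda>n. avoid v (Suc n) z) \<longlonglongrightarrow> of_bool (z \<noteq> v) * (\<Sum>w\<in>V. srw_prob V E z w * G w)"
      unfolding avoid_prob.simps by (intro tendsto_intros G)
  qed
  have nonneg: "G z \<ge> 0" if "z \<in> V" for z
    using G[OF that] avoid_bounds(1) by (intro LIMSEQ_le_const) auto
  let ?m = "Max (G ` V)"
  have max: "G z \<le> ?m" if "z \<in> V" for z
    using that finite_V by simp
  have "?m \<le> 0"
  proof (rule ccontr)
    assume pos: "\<not> ?m \<le> 0"
    \<comment> \<open>At a vertex other than \<open>v\<close>, \<open>G\<close> is an average over
      the neighbours, so a positive maximum is attained at all of them. By connectivity it spreads
      to \<open>v\<close>, where \<open>G\<close> is 0.\<close>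
    have spread: "G w = ?m" if "z \<in> V" "G z = ?m" "w \<in> nb z" for z w
    proof (rule ccontr)
      assume "G w \<noteq> ?m"
      with max[of w] that have less: "G w < ?m"
        by simp
      have "z \<noteq> v"
        using harmonic[OF that(1)] that(2) pos by auto
      have "srw_prob V E z w > 0"
        using that(3) srw_prob_edge[of z w] finite_V
        by (auto simp: graph_degree_def card_gt_0_iff)
      then have "(\<Sum>w\<in>V. srw_prob V E z w * G w) < (\<Sum>w\<in>V. srw_prob V E z w * ?m)"
      proof (intro sum_strict_mono_ex1 finite_V ballI)
        show "\<exists>w\<in>V. srw_prob V E z w * G w < srw_prob V E z w * ?m"
          using that(3) less \<open>srw_prob V E z w > 0\<close> by (intro bexI[of _ w]) simp_all
      qed (intro mult_left_mono max srw_prob_nonneg)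
      also have "\<dots> = ?m"
        using sum_srw_prob[OF that(1)] by (simp flip: sum_distrib_right)
      finally show False
        using harmonic[OF that(1)] that(2) \<open>z \<noteq> v\<close> by simp
    qed
    have "?m \<in> G ` V"
      using finite_V V_nonempty by simp
    then obtain z where z: "z \<in> V" "G z = ?m"
      by auto
    have "(z, v) \<in> (adj V E)\<^sup>*"
      using bspec[OF bspec[OF connected[unfolded graph_connected_iff_rtrancl] z(1)] assms(1)] .
    then have "v \<in> V \<and> G v = ?m"
    proof (induction rule: rtrancl_induct)
      case (step y w)
      then have "w \<in> nb y" "y \<in> V" "G y = ?m"
        by auto
      then show ?case
        using spread[of y w] by blast
    qed (use z in blast)
    then have "G v = ?m" ..
    then show False
      using harmonic[OF assms(1)] pos by simp
  qed
  then have "G x = 0"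
    using max[OF assms(2)] nonneg[OF assms(2)] by simp
  then show ?thesis
    using G[OF assms(2)] by simp
qed

end

section \<open>Path probabilities and almost sure covering\<close>

locale graph_walk = connected_graph V E for V :: "'a set" and E :: "'a set set" +
  fixes M :: "'w measure" and X :: "nat \<Rightarrow> 'w \<Rightarrow> 'a"
  assumes walk: "simple_random_walk V E M X"
begin

sublocale prob_space M
  using walk by (simp add: simple_random_walk_def)

lemma X_measurable: "X n \<in> measurable M (count_space V)"
  using walk by (simp add: simple_random_walk_def)

lemma X_in_V: "\<omega> \<in> space M \<Longrightarrow> X n \<omega> \<in> V"
  using measurable_space[OF X_measurable] by simp

lemma pred_X [measurable]: "Measurable.pred M (\<lambda>\<omega>. X n \<omega> = a)"
proof -
  have "{\<omega> \<in> space M. X n \<omega> = a} = X n -` ({a} \<inter> V) \<inter> space M"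
    using X_in_V by auto
  also have "\<dots> \<in> sets M"
    by (rule measurable_sets[OF X_measurable]) simp
  finally show ?thesis
    by (simp add: pred_def)
qed

definition starts :: "'a list \<Rightarrow> 'w set" where
  "starts p = {\<omega> \<in> space M. \<forall>i<length p. X i \<omega> = p ! i}"

lemma starts_sets [measurable]: "starts p \<in> sets M"
  unfolding starts_def by measurable

lemma starts_iff: "\<omega> \<in> starts p \<longleftrightarrow> \<omega> \<in> space M \<and> map (\<lambda>i. X i \<omega>) [0..<length p] = p"
  unfolding starts_def by (subst list_eq_iff_nth_eq) simp

lemma prob_starts_snoc:
  assumes "p \<noteq> []" "z \<in> V"
  shows "prob (starts (p @ [z])) = prob (starts p) * srw_prob V E (last p) z"
proof (cases "prob (starts p) = 0")
  \<comment> \<open>The walk is specified by conditional probabilities given events of positive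
    probability; on a null cylinder both sides vanish.\<close>
  case True
  moreover have "prob (starts (p @ [z])) \<le> prob (starts p)"
    by (intro finite_measure_mono) (auto simp: starts_def nth_append less_Suc_eq)
  ultimately show ?thesis
    using measure_nonneg[of M "starts (p @ [z])"] by simp
next
  case False
  define n where "n = length p - 1"
  have n: "length p = Suc n"
    using assms(1) by (simp add: n_def)
  let ?x = "\<lambda>i. p ! i"
  have eq: "{\<omega> \<in> space M. \<forall>i\<le>n. X i \<omega> = ?x i} = starts p"
    by (auto simp: starts_def n less_Suc_eq_le)
  have eq': "{\<omega> \<in> space M. X (Suc n) \<omega> = z \<and> (\<forall>i\<le>n. X i \<omega> = ?x i)} = starts (p @ [z])"
    by (auto simp: starts_def n less_Suc_eq_le nth_append le_Suc_eq)
  have "\<P>(\<omega> in M. \<forall>i\<le>n. X i \<omega> = ?x i) > 0"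
    using False unfolding eq by (simp add: less_le)
  then have "\<P>(\<omega> in M. X (Suc n) \<omega> = z \<bar> \<forall>i\<le>n. X i \<omega> = ?x i) = srw_prob V E (?x n) z"
    using walk assms(2) unfolding simple_random_walk_def by blast
  moreover have "?x n = last p"
    using assms(1) by (simp add: last_conv_nth n_def)
  ultimately show ?thesis
    using False by (simp add: cond_prob_def eq eq' field_simps)
qed

lemma prob_starts:
  assumes "graph_path V E p"
  shows "prob (starts p) = prob (starts [hd p]) * weight p"
proof -
  have "p \<noteq> []"
    using assms by (simp add: graph_path_def)
  then show ?thesis
    using assms
  proof (induction p rule: rev_nonempty_induct)
    case (single x)
    then show ?case
      by (simp add: walk_weight_def)
  next
    case (snoc z p)
    have path: "graph_path V E p" "{last p, z} \<in> E" "z \<in> V"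
      using snoc.prems snoc.hyps by (auto simp: graph_path_def successively_append_iff)
    have "weight (p @ [z]) = weight p / deg (last p)"
      using snoc.hyps by (cases p rule: rev_cases) (simp_all add: walk_weight_def butlast_append)
    then show ?case
      using snoc path by (simp add: prob_starts_snoc srw_prob_edge)
  qed
qed

lemma graph_path_if_prob_starts:
  assumes "p \<noteq> []" "set p \<subseteq> V" "prob (starts p) \<noteq> 0" "\<And>x. x \<in> V \<Longrightarrow> deg x \<noteq> 0"
  shows "graph_path V E p"
  using assms(1-3)
proof (induction p rule: rev_nonempty_induct)
  case (single x)
  then show ?case
    by (simp add: graph_path_def)
next
  case (snoc z p)
  have "prob (starts p) \<noteq> 0" "srw_prob V E (last p) z \<noteq> 0"
    using snoc.prems snoc.hyps by (auto simp: prob_starts_snoc)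
  moreover have "last p \<in> V"
    using snoc.prems snoc.hyps by auto
  ultimately show ?case
    using snoc assms(4)[of "last p"]
    by (auto simp: graph_path_def successively_append_iff srw_prob_def split: if_splits)
qed

text \<open>By the staying-put convention a one-vertex walk follows no edge, but there the only
  first cover is the single vertex. In all other cases no degree is zero and steps of positive
  probability are edges.\<close>

lemma first_cover_graph_path:
  assumes "first_cover V p" "prob (starts p) \<noteq> 0"
  shows "graph_path V E p"
proof (cases "\<exists>x\<in>V. deg x = 0")
  case True
  then obtain x where V: "V = {x}"
    using deg_zero by blast
  obtain q y where p: "p = q @ [y]"
    using assms(1) by (cases p rule: rev_cases) (auto simp: first_cover_def)
  then have "q = []"
    using assms(1) V by (cases q) (auto simp: first_cover_def)
  then show ?thesis
    using assms(1) p by (auto simp: first_cover_def graph_path_def)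
next
  case False
  then show ?thesis
    using assms by (intro graph_path_if_prob_starts) (auto simp: first_cover_def)
qed

lemma sum_prob_starts: "(\<Sum>x\<in>V. prob (starts [x])) = 1"
proof -
  have "prob (\<Union>x\<in>V. starts [x]) = (\<Sum>x\<in>V. prob (starts [x]))"
    using finite_V by (intro finite_measure_finite_Union) (auto simp: disjoint_family_on_def starts_def)
  moreover have "(\<Union>x\<in>V. starts [x]) = space M"
    using X_in_V by (auto simp: starts_def)
  ultimately show ?thesis
    using prob_space by simp
qed

text \<open>The Markov property at time \<open>length p - 1\<close>, when the walk is at
  \<open>last p\<close>; that time itself counts as the first of the \<open>n + 1\<close> times of
  avoidance.\<close>

lemma prob_starts_avoid:
  assumes "p \<noteq> []" "set p \<subseteq> V"
  shows "prob {\<omega> \<in> starts p. \<forall>i\<le>n. X (length p - 1 + i) \<omega> \<noteq> v} =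
    prob (starts p) * avoid v n (last p)"
  using assms
proof (induction n arbitrary: p)
  case 0
  have "X (length p - 1) \<omega> = last p" if "\<omega> \<in> starts p" for \<omega>
    using that 0 by (auto simp: starts_def last_conv_nth)
  then have "{\<omega> \<in> starts p. \<forall>i\<le>0. X (length p - 1 + i) \<omega> \<noteq> v} =
      (if last p = v then {} else starts p)"
    by auto
  then show ?case
    by auto
next
  case (Suc n)
  let ?A = "\<lambda>n p. {\<omega> \<in> starts p. \<forall>i\<le>n. X (length p - 1 + i) \<omega> \<noteq> v}"
  have last: "X (length p - 1) \<omega> = last p" if "\<omega> \<in> starts p" for \<omega>
    using that Suc.prems by (auto simp: starts_def last_conv_nth)
  show ?case
  proof (cases "last p = v")
    case True
    then have empty: "?A (Suc n) p = {}"
      using last by (auto intro!: exI[of _ 0])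
    show ?thesis
      unfolding empty using True by simp
  next
    case False
    have sets: "?A n q \<in> sets M" for q
    proof -
      have "?A n q = starts q \<inter> {\<omega> \<in> space M. \<forall>i\<le>n. X (length q - 1 + i) \<omega> \<noteq> v}"
        by (auto simp: starts_def)
      also have "\<dots> \<in> sets M"
        by measurable
      finally show ?thesis .
    qed
    \<comment> \<open>Split by the next vertex; \<open>last p\<close> differs from \<open>v\<close>,
      so the first time imposes nothing.\<close>
    have "?A (Suc n) p = (\<Union>z\<in>V. ?A n (p @ [z]))"
    proof (intro set_eqI)
      fix \<omega>
      have "(\<forall>i\<le>Suc n. X (length p - 1 + i) \<omega> \<noteq> v) \<longleftrightarrow> (\<forall>i\<le>n. X (length p + i) \<omega> \<noteq> v)"
        if "\<omega> \<in> starts p"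
      proof -
        have "length p - 1 + Suc i = length p + i" for i
          using Suc.prems(1) by (cases p) auto
        moreover have "(\<forall>i\<le>Suc n. P i) \<longleftrightarrow> P 0 \<and> (\<forall>i\<le>n. P (Suc i))" for P
          by (metis Suc_le_mono le0 not0_implies_Suc)
        ultimately show ?thesis
          using last[OF that] False by simp
      qed
      moreover have "\<omega> \<in> starts (p @ [z]) \<longleftrightarrow> \<omega> \<in> starts p \<and> X (length p) \<omega> = z" for z
        by (auto simp: starts_def nth_append less_Suc_eq)
      moreover have "\<omega> \<in> starts p \<Longrightarrow> X (length p) \<omega> \<in> V"
        using X_in_V by (simp add: starts_def)
      ultimately show "\<omega> \<in> ?A (Suc n) p \<longleftrightarrow> \<omega> \<in> (\<Union>z\<in>V. ?A n (p @ [z]))"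
        by auto
    qed
    then have "prob (?A (Suc n) p) = (\<Sum>z\<in>V. prob (?A n (p @ [z])))"
      using finite_V sets
      by (simp only:) (intro finite_measure_finite_Union,
        auto simp: disjoint_family_on_def starts_def nth_append)
    also have "\<dots> = (\<Sum>z\<in>V. prob (starts p) * (srw_prob V E (last p) z * avoid v n z))"
    proof (rule sum.cong)
      fix z assume "z \<in> V"
      then show "prob (?A n (p @ [z])) = prob (starts p) * (srw_prob V E (last p) z * avoid v n z)"
        using Suc.IH[of "p @ [z]"] Suc.prems by (simp add: prob_starts_snoc)
    qed simp
    finally show ?thesis
      using False by (simp add: sum_distrib_left)
  qed
qed

lemma AE_visits:
  assumes "v \<in> V"
  shows "AE \<omega> in M. \<exists>i. X i \<omega> = v"
proof -
  let ?A = "\<lambda>n. {\<omega> \<in> space M. \<forall>i\<le>n. X i \<omega> \<noteq> v}"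
  let ?N = "{\<omega> \<in> space M. \<forall>i. X i \<omega> \<noteq> v}"
  have A: "prob (?A n) = (\<Sum>x\<in>V. prob (starts [x]) * avoid v n x)" for n
  proof -
    have "?A n \<in> sets M"
      by measurable
    then have "prob (\<Union>x\<in>V. starts [x] \<inter> ?A n) = (\<Sum>x\<in>V. prob (starts [x] \<inter> ?A n))"
      by (intro finite_measure_finite_Union finite_V image_subsetI sets.Int starts_sets)
        (auto simp: disjoint_family_on_def starts_def)
    moreover have "(\<Union>x\<in>V. starts [x] \<inter> ?A n) = ?A n"
      using X_in_V by (auto simp: starts_def)
    moreover have "prob (starts [x] \<inter> ?A n) = prob (starts [x]) * avoid v n x" if "x \<in> V" for x
    proof -
      have "starts [x] \<inter> ?A n = {\<omega> \<in> starts [x]. \<forall>i\<le>n. X (length [x] - 1 + i) \<omega> \<noteq> v}"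
        by (auto simp: starts_def)
      then show ?thesis
        using prob_starts_avoid[of "[x]" n v] that by simp
    qed
    ultimately show ?thesis
      by simp
  qed
  have "(\<lambda>n. \<Sum>x\<in>V. prob (starts [x]) * avoid v n x) \<longlonglongrightarrow> (\<Sum>x\<in>V. prob (starts [x]) * 0)"
    using assms by (intro tendsto_intros avoid_tendsto_0)
  moreover have "prob ?N \<le> prob (?A n)" for n
    by (intro finite_measure_mono) (auto, measurable)
  ultimately have "prob ?N \<le> 0"
    using A by (intro LIMSEQ_le_const[where X = "\<lambda>n. prob (?A n)"]) auto
  then have "prob ?N = 0"
    using measure_nonneg[of M ?N] by simp
  moreover have "?N \<in> sets M"
    by measurable
  ultimately have "?N \<in> null_sets M"
    by (simp add: emeasure_eq_measure null_setsI)
  then show ?thesis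
    by (rule AE_I') auto
qed

lemma cover_time_finite: "AE \<omega> in M. cover_time V (\<lambda>n. X n \<omega>) < \<infinity>"
proof -
  have "AE \<omega> in M. \<forall>v\<in>V. \<exists>i. X i \<omega> = v"
    using AE_visits finite_V by (intro AE_finite_allI)
  then show ?thesis
  proof (rule AE_mp, intro AE_I2 impI)
    fix \<omega> assume \<omega>: "\<omega> \<in> space M" "\<forall>v\<in>V. \<exists>i. X i \<omega> = v"
    then obtain f where f: "\<forall>v\<in>V. X (f v) \<omega> = v"
      by metis
    let ?n = "Max (f ` V)"
    have "(\<lambda>n. X n \<omega>) ` {..?n} = V"
    proof
      show "V \<subseteq> (\<lambda>n. X n \<omega>) ` {..?n}"
      proof
        fix v assume "v \<in> V"
        then show "v \<in> (\<lambda>n. X n \<omega>) ` {..?n}"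
          using f finite_V by (intro image_eqI[of _ _ "f v"]) auto
      qed
    qed (use X_in_V \<omega> in auto)
    then have "cover_time V (\<lambda>n. X n \<omega>) \<le> enat ?n"
      unfolding cover_time_def by (intro Inf_lower) blast
    then show "cover_time V (\<lambda>n. X n \<omega>) < \<infinity>"
      using enat_ord_simps(4) le_less_trans by blast
  qed
qed

section \<open>The law of the last-exit tree\<close>

definition T :: "'w \<Rightarrow> 'a set set" where
  "T \<omega> = last_exit_tree V (\<lambda>n. X n \<omega>)"

lemma T_eq_exit_tree:
  assumes "first_cover V p" "\<omega> \<in> starts p"
  shows "T \<omega> = exit_tree p" "cover_time V (\<lambda>n. X n \<omega>) \<noteq> \<infinity>"
proof -
  have "length p = Suc (length p - 1)"
    using assms(1) by (cases p) (auto simp: first_cover_def)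
  then have p: "map (\<lambda>n. X n \<omega>) [0..<Suc (length p - 1)] = p"
    using assms(2) starts_iff by metis
  then have ct: "cover_time V (\<lambda>n. X n \<omega>) = enat (length p - 1)"
    using assms(1) by (simp only: cover_time_eq_iff)
  show "T \<omega> = exit_tree p"
    unfolding T_def last_exit_tree_def ct enat.case last_exit_edges_eq p ..
  show "cover_time V (\<lambda>n. X n \<omega>) \<noteq> \<infinity>"
    by (simp add: ct)
qed

lemma first_cover_exists:
  assumes "\<omega> \<in> space M" "cover_time V (\<lambda>n. X n \<omega>) \<noteq> \<infinity>"
  obtains p where "first_cover V p" "\<omega> \<in> starts p"
proof -
  obtain n where n: "cover_time V (\<lambda>n. X n \<omega>) = enat n"
    using assms(2) by auto
  let ?p = "map (\<lambda>i. X i \<omega>) [0..<Suc n]"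
  have "first_cover V ?p"
    using n by (simp only: cover_time_eq_iff)
  moreover have "\<omega> \<in> starts ?p"
    using assms(1) unfolding starts_iff by (simp del: upt_Suc)
  ultimately show ?thesis
    by (rule that)
qed

lemma countable_first_cover: "countable {p. first_cover V p \<and> P p}"
  by (rule countable_subset[of _ "lists V"])
    (use finite_V in \<open>auto simp: first_cover_def countable_finite\<close>)

text \<open>There are only countably many first covers, so every preimage is a countable union of
  cylinders, together with the non-covering event if \<open>A\<close> contains the dummy
  value.\<close>

lemma T_measurable [measurable]: "T \<in> measurable M (count_space UNIV)"
proof (rule measurableI)
  fix A :: "'a set set set"
  let ?U = "\<lambda>P. \<Union>p\<in>{p. first_cover V p \<and> P p}. starts p"
  have U: "?U P \<in> sets M" for P
    using countable_first_cover by (intro sets.countable_UN') auto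
  have "T -` A \<inter> space M =
      ?U (\<lambda>p. exit_tree p \<in> A) \<union> (if {} \<in> A then space M - ?U (\<lambda>_. True) else {})"
    (is "?L = ?R")
  proof (intro set_eqI)
    fix \<omega>
    show "\<omega> \<in> ?L \<longleftrightarrow> \<omega> \<in> ?R"
    proof (cases "\<omega> \<in> space M \<and> cover_time V (\<lambda>n. X n \<omega>) \<noteq> \<infinity>")
      case True
      then obtain p where p: "first_cover V p" "\<omega> \<in> starts p"
        using first_cover_exists by blast
      have "T \<omega> \<in> A \<longleftrightarrow> \<omega> \<in> ?U (\<lambda>p. exit_tree p \<in> A)"
      proof
        assume "T \<omega> \<in> A"
        then have "exit_tree p \<in> A"
          using T_eq_exit_tree(1)[OF p] by simp
        then show "\<omega> \<in> ?U (\<lambda>p. exit_tree p \<in> A)"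
          using p by blast
      next
        assume "\<omega> \<in> ?U (\<lambda>p. exit_tree p \<in> A)"
        then obtain q where "first_cover V q" "exit_tree q \<in> A" "\<omega> \<in> starts q"
          by blast
        then show "T \<omega> \<in> A"
          using T_eq_exit_tree(1) by simp
      qed
      moreover have "\<omega> \<in> ?U (\<lambda>_. True)"
        using p by blast
      ultimately show ?thesis
        using True by simp
    next
      case False
      have "\<omega> \<notin> ?U P" for P
      proof
        assume "\<omega> \<in> ?U P"
        then obtain q where q: "first_cover V q" "\<omega> \<in> starts q"
          by blast
        then show False
          using False T_eq_exit_tree(2)[OF q] by (simp add: starts_iff)
      qed
      moreover have "\<omega> \<in> space M \<Longrightarrow> T \<omega> = {}"
        using False by (simp add: T_def last_exit_tree_def)
      ultimately show ?thesis
        by auto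
    qed
  qed
  moreover have "(if {} \<in> A then space M - ?U (\<lambda>_. True) else {}) \<in> sets M"
  proof (cases "{} \<in> A")
    case True
    show ?thesis
      unfolding if_P[OF True] by (rule sets.compl_sets[OF U])
  qed simp
  ultimately show "T -` A \<inter> space M \<in> sets M"
    using U by (simp only: sets.Un)
qed simp

lemma AE_T_in_trees: "AE \<omega> in M. T \<omega> \<in> spanning"
proof -
  \<comment> \<open>Countably many null cylinders are discarded, so that the observed first cover
    has positive probability and is a graph path.\<close>
  have "AE \<omega> in M. \<forall>p\<in>{p. first_cover V p \<and> True}. \<omega> \<in> starts p \<longrightarrow> prob (starts p) \<noteq> 0"
  proof (subst AE_ball_countable[OF countable_first_cover], intro ballI)
    fix p
    show "AE \<omega> in M. \<omega> \<in> starts p \<longrightarrow> prob (starts p) \<noteq> 0"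
    proof (cases "prob (starts p) = 0")
      case True
      then have "starts p \<in> null_sets M"
        by (simp add: emeasure_eq_measure null_setsI)
      then show ?thesis
        by (rule AE_I'[of "starts p"]) auto
    qed simp
  qed
  then show ?thesis
    using cover_time_finite AE_space
  proof eventually_elim
    case (elim \<omega>)
    then obtain p where p: "first_cover V p" "\<omega> \<in> starts p"
      using first_cover_exists[of \<omega>] by auto
    then have "graph_path V E p"
      using elim(1) first_cover_graph_path by simp
    then have "exit_tree p \<in> spanning"
      using p(1) by (intro exit_tree_in_trees) (auto simp: first_cover_def)
    then show ?case
      using T_eq_exit_tree(1)[OF p] by simp
  qed
qed

text \<open>\<open>exit_tree_bound\<close> needs finite sets of walks, so it is applied for each
  start to first covers of length at most \<open>n\<close> and averaged over the starting law. As
  \<open>n\<close> grows these exhaust the event up to a null set.\<close>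

lemma prob_T_eq_le: "prob (T -` {t} \<inter> space M) * card spanning \<le> 1"
proof -
  define B where "B n = {p. (first_cover V p \<and> exit_tree p = t) \<and> length p \<le> n}" for n
  have fin: "finite (B n)" for n
    by (rule finite_subset[OF _ finite_lists_length_le[OF finite_V, of n]])
      (auto simp: B_def first_cover_def)
  have bound: "prob (\<Union>p\<in>B n. starts p) * card spanning \<le> 1" for n
  proof -
    define D where "D x = {p \<in> B n. graph_path V E p \<and> hd p = x}" for x
    have fin_D: "finite (D x)" for x
      by (rule finite_subset[OF _ fin[of n]]) (auto simp: D_def)
    have "prob (\<Union>p\<in>B n. starts p) \<le> (\<Sum>p\<in>B n. prob (starts p))"
      using fin by (intro finite_measure_subadditive_finite) auto
    \<comment> \<open>First covers that are not graph paths have probability 0 and drop out.\<close>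
    also have "\<dots> = (\<Sum>p\<in>(\<Union>x\<in>V. D x). prob (starts p))"
    proof (rule sum.mono_neutral_right[OF fin])
      show "(\<Union>x\<in>V. D x) \<subseteq> B n"
        by (auto simp: D_def)
      show "\<forall>p\<in>B n - (\<Union>x\<in>V. D x). prob (starts p) = 0"
      proof (rule ballI, rule ccontr)
        fix p assume p: "p \<in> B n - (\<Union>x\<in>V. D x)" "prob (starts p) \<noteq> 0"
        then have "first_cover V p"
          by (auto simp: B_def)
        then have "graph_path V E p" "hd p \<in> V"
          using first_cover_graph_path[OF _ p(2)] by (auto simp: first_cover_def)
        then show False
          using p(1) by (auto simp: D_def)
      qed
    qed
    also have "\<dots> = (\<Sum>x\<in>V. \<Sum>p\<in>D x. prob (starts p))"
      using fin_D finite_V by (intro sum.UNION_disjoint) (auto simp: D_def)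
    also have "\<dots> = (\<Sum>x\<in>V. prob (starts [x]) * (\<Sum>p\<in>D x. weight p))"
      unfolding sum_distrib_left by (intro sum.cong refl) (auto simp: D_def prob_starts)
    finally have "prob (\<Union>p\<in>B n. starts p) * card spanning \<le>
        (\<Sum>x\<in>V. prob (starts [x]) * (\<Sum>p\<in>D x. weight p)) * card spanning"
      by (intro mult_right_mono) auto
    also have "\<dots> = (\<Sum>x\<in>V. prob (starts [x]) * ((\<Sum>p\<in>D x. weight p) * card spanning))"
      by (simp add: sum_distrib_right mult.assoc)
    also have "\<dots> \<le> (\<Sum>x\<in>V. prob (starts [x]) * 1)"
    proof (intro sum_mono mult_left_mono)
      fix x assume "x \<in> V"
      then show "(\<Sum>p\<in>D x. weight p) * card spanning \<le> 1"
        using fin_D by (intro exit_tree_bound[where x = x and t = t]) (auto simp: D_def B_def)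
    qed simp
    finally show ?thesis
      using sum_prob_starts by simp
  qed
  have U: "(\<Union>n. \<Union>p\<in>B n. starts p) = (\<Union>p\<in>{p. first_cover V p \<and> exit_tree p = t}. starts p)"
    by (auto simp: B_def)
  have "(\<lambda>n. prob (\<Union>p\<in>B n. starts p)) \<longlonglongrightarrow> prob (\<Union>n. \<Union>p\<in>B n. starts p)"
  proof (rule finite_Lim_measure_incseq)
    show "range (\<lambda>n. \<Union>p\<in>B n. starts p) \<subseteq> sets M"
      using fin by auto
    show "incseq (\<lambda>n. \<Union>p\<in>B n. starts p)"
      by (rule incseq_SucI) (auto simp: B_def)
  qed
  then have "(\<lambda>n. prob (\<Union>p\<in>B n. starts p) * card spanning) \<longlonglongrightarrow>
      prob (\<Union>n. \<Union>p\<in>B n. starts p) * card spanning"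
    by (intro tendsto_intros)
  then have "prob (\<Union>n. \<Union>p\<in>B n. starts p) * card spanning \<le> 1"
    using bound by (intro LIMSEQ_le_const2) auto
  moreover have "prob (T -` {t} \<inter> space M) \<le> prob (\<Union>n. \<Union>p\<in>B n. starts p)"
  proof (rule finite_measure_mono_AE)
    show "AE \<omega> in M. \<omega> \<in> T -` {t} \<inter> space M \<longrightarrow> \<omega> \<in> (\<Union>n. \<Union>p\<in>B n. starts p)"
      using cover_time_finite AE_space
    proof eventually_elim
      case (elim \<omega>)
      then obtain p where p: "first_cover V p" "\<omega> \<in> starts p"
        using first_cover_exists[of \<omega>] by auto
      show ?case
        unfolding U using p T_eq_exit_tree(1)[OF p] by auto
    qed
    have "(\<Union>p\<in>B n. starts p) \<in> sets M" for n
      using fin by auto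
    then show "(\<Union>n. \<Union>p\<in>B n. starts p) \<in> sets M"
      by (intro sets.countable_UN image_subsetI)
  qed
  ultimately show ?thesis
    by (meson dual_order.trans mult_right_mono of_nat_0_le_iff)
qed

lemma prob_T_in:
  "prob (T -` A \<inter> space M) = (\<Sum>t\<in>spanning \<inter> A. prob (T -` {t} \<inter> space M))"
proof -
  have sets: "T -` B \<inter> space M \<in> sets M" for B
    using T_measurable by (rule measurable_sets) simp
  have "prob (T -` A \<inter> space M) = prob (\<Union>t\<in>spanning \<inter> A. T -` {t} \<inter> space M)"
  proof (rule finite_measure_eq_AE)
    show "AE \<omega> in M. \<omega> \<in> T -` A \<inter> space M \<longleftrightarrow>
        \<omega> \<in> (\<Union>t\<in>spanning \<inter> A. T -` {t} \<inter> space M)"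
      using AE_T_in_trees by eventually_elim auto
    show "(\<Union>t\<in>spanning \<inter> A. T -` {t} \<inter> space M) \<in> sets M"
      using sets finite_trees by (intro sets.finite_UN) auto
  qed (rule sets)
  also have "\<dots> = (\<Sum>t\<in>spanning \<inter> A. prob (T -` {t} \<inter> space M))"
    using finite_trees sets
    by (intro finite_measure_finite_Union) (auto simp: disjoint_family_on_def)
  finally show ?thesis .
qed

text \<open>Almost surely \<open>T\<close> is itself a spanning tree; without any, the total mass
  would be 0.\<close>

lemma spanning_nonempty: "spanning \<noteq> {}"
proof
  assume "spanning = {}"
  then have "prob (T -` UNIV \<inter> space M) = 0"
    using prob_T_in[of UNIV] by simp
  then show False
    using prob_space by simp
qed

text \<open>The probabilities sum to 1 over \<open>card spanning\<close> trees, and none exceeds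
  \<open>1 / card spanning\<close>; so none can fall short.\<close>

lemma prob_T_eq:
  assumes "t \<in> spanning"
  shows "prob (T -` {t} \<inter> space M) = 1 / card spanning"
proof -
  let ?N = "card spanning"
  have N: "?N > 0"
    using spanning_nonempty finite_trees by (simp add: card_gt_0_iff)
  have le: "prob (T -` {t} \<inter> space M) \<le> 1 / ?N" for t
    using prob_T_eq_le[of t] N by (simp add: pos_le_divide_eq)
  have "(\<Sum>t\<in>spanning. 1 / ?N - prob (T -` {t} \<inter> space M)) = 0"
    using prob_T_in[of UNIV] prob_space N by (simp add: sum_subtractf)
  then have "1 / ?N - prob (T -` {t} \<inter> space M) = 0"
    using sum_nonneg_eq_0_iff[OF finite_trees, of "\<lambda>t. 1 / ?N - prob (T -` {t} \<inter> space M)"]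
      le assms by simp
  then show ?thesis
    by simp
qed

lemma distr_T: "distr M (count_space UNIV) T = measure_pmf (UST V E)"
proof (rule measure_eqI)
  fix A
  have "emeasure (distr M (count_space UNIV) T) A = ennreal (prob (T -` A \<inter> space M))"
    by (simp add: emeasure_distr emeasure_eq_measure)
  also have "prob (T -` A \<inter> space M) = card (spanning \<inter> A) / card spanning"
    unfolding prob_T_in[of A] by (simp add: prob_T_eq)
  also have "ennreal \<dots> = emeasure (measure_pmf (UST V E)) A"
    unfolding UST_def using emeasure_pmf_of_set[OF spanning_nonempty finite_trees, of A] by simp
  finally show "emeasure (distr M (count_space UNIV) T) A = emeasure (measure_pmf (UST V E)) A" .
qed simp

end

theorem theorem1p1:
  fixes V :: "'a set" and E :: "'a set set"
    and M :: "'w measure" and X :: "nat \<Rightarrow> 'w \<Rightarrow> 'a"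
  assumes "finite_simple_graph V E"
    and "graph_connected V E"
    and "simple_random_walk V E M X"
  defines "T \<equiv> \<lambda>\<omega>. last_exit_tree V (\<lambda>n. X n \<omega>)"
  shows "(AE \<omega> in M. cover_time V (\<lambda>n. X n \<omega>) < \<infinity>) \<and>
         T \<in> measurable M (count_space UNIV) \<and>
         distr M (count_space UNIV) T = measure_pmf (UST V E)"
proof -
  interpret graph_walk V E M X
    using assms(1-3) by unfold_locales
  have "T = graph_walk.T V X"
    unfolding assms(4) by (intro ext) (simp add: T_def)
  then show ?thesis
    using cover_time_finite T_measurable distr_T by simp
qed

end
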